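(* Let $H=\tfrac14$ and $\nu=\tfrac34$. Then for all $\beta\in\mathbb{R}$ and $t>0$, $$ E_{\frac34,\frac13,-\frac23}\left(-\tfrac14\beta^2t^{1/4}\right)=\frac{\Gamma(3/4)}{\pi\sqrt2}\int_0^\infty e^{-w}w^{-3/4}e^{-\beta^2\sqrt[4]{tw}}\,\mathrm dw , $$ and the solution $$ u(x,t)=\frac{1}{2\pi}\int_{-\infty}^{+\infty}e^{-i\beta x}E_{\frac34,\frac13,-\frac23}\left(-\tfrac14\beta^2t^{1/4}\right)\mathrm d\beta $$ of the problem $$ {}^CD^{3/4}_{0^+}u(x,t)=\tfrac14\,t^{-1/2}\,\frac{\partial^2}{\partial x^2}u(x,t),\quad x\in\mathbb{R},\ t>0,\qquad u(x,0)=\delta(x), $$ is given by $$ u(x,t)=\frac{\sqrt2\,\Gamma(3/4)}{\pi\sqrt[4]{t}}\int_0^\infty\frac{e^{-\frac{x^2}{2w}}}{\sqrt{2\pi w}}\,e^{-\frac{w^4}{2^4t}}\,\mathrm dw . $$ That is, $u(\cdot,t)$ is the probability density of the random variable $B(W_t)$, where $B$ is a standard Brownian motion and $W_t$ is a positive random variable, independent of $B$, with density $$ \mathbb{P}\{W_t\in\mathrm dz\}/\mathrm dz=\frac{\sqrt2\,\Gamma(3/4)\,e^{-\frac{z^4}{2^4t}}}{\pi\sqrt[4]{t}},\qquad z>0 . $$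
   Context: $\delta$ is the Dirac delta at $0$. ${}^C D^\nu_{0^+}$ is the Caputo derivative in $t$: for $\nu\in(0,1)$, ${}^C D^\nu_{0^+}f(t)=\frac{1}{\Gamma(1-\nu)}\int_0^t (t-s)^{-\nu}f'(s)\,\mathrm ds$. The generalized (Kilbas–Saigo) three-index Mittag–Leffler function is $$E_{a,m,l}(z)=1+\sum_{k=1}^\infty z^k\prod_{j=0}^{k-1}\frac{\Gamma\left(a(jm+l)+1\right)}{\Gamma\left(a(jm+l+1)+1\right)},$$ for $a,m>0$, $l\in\mathbb{R}$ with $a(jm+l)\notin\{-1,-2,\dots\}$ for all $j\ge0$. The problem with datum $\delta$ is understood through the Fourier transform in $x$, $U(\beta,t)=\int_{\mathbb R}e^{i\beta x}u(x,t)\,\mathrm dx$: for every $\beta$, ${}^CD^{3/4}_{0^+}U(\beta,t)=-\tfrac14t^{-1/2}\beta^2U(\beta,t)$ for $t>0$, and $U(\beta,0)=1$. *)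

theory Defs
  imports "HOL-Probability.Probability"
begin

definition kilbas_saigo :: "real \<Rightarrow> real \<Rightarrow> real \<Rightarrow> 'a \<Rightarrow> 'a::{real_normed_field, banach}" where
  "kilbas_saigo a m l z =
     1 + (\<Sum>k. z ^ Suc k *
           of_real (\<Prod>j = 0..k. Gamma (a * (real j * m + l) + 1) / Gamma (a * (real j * m + l + 1) + 1)))"

definition caputo_integrand ::
    "real \<Rightarrow> (real \<Rightarrow> 'a::{banach, second_countable_topology}) \<Rightarrow> real \<Rightarrow> real \<Rightarrow> 'a" where
  "caputo_integrand \<nu> f t s = (t - s) powr (- \<nu>) *\<^sub>R vector_derivative f (at s)"

definition caputo ::
    "real \<Rightarrow> (real \<Rightarrow> 'a::{banach, second_countable_topology}) \<Rightarrow> real \<Rightarrow> 'a" where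
  "caputo \<nu> f t = (1 / Gamma (1 - \<nu>)) *\<^sub>R (LBINT s:{0<..<t}. caputo_integrand \<nu> f t s)"

(* The Caputo derivative at t is meaningful (its integral converges absolutely). *)
definition caputo_exists ::
    "real \<Rightarrow> (real \<Rightarrow> 'a::{banach, second_countable_topology}) \<Rightarrow> real \<Rightarrow> bool" where
  "caputo_exists \<nu> f t \<longleftrightarrow>
     (\<forall>s\<in>{0<..<t}. f differentiable (at s)) \<and>
     set_integrable lborel {0<..<t} (caputo_integrand \<nu> f t)"

(* The Cauchy problem after Fourier transform in x; the datum 1 is the transform of the Dirac
   delta. The Caputo derivative only sees f' on (0,t), so continuity on [0,\<infinity>) is what ties
   the initial value to the equation. *)
definition fourier_problem :: "(real \<Rightarrow> real \<Rightarrow> complex) \<Rightarrow> bool" where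
  "fourier_problem U \<longleftrightarrow>
     (\<forall>\<beta>. U \<beta> 0 = 1 \<and> continuous_on {0..} (U \<beta>) \<and>
        (\<forall>t>0. caputo_exists (3/4) (U \<beta>) t \<and>
           caputo (3/4) (U \<beta>) t = - of_real (1/4 * t powr (-1/2) * \<beta>\<^sup>2) * U \<beta> t))"

(* u x t, t > 0, solves D^(3/4) u = (1/4) t^(-1/2) u_xx with u(x,0) = delta(x), in the sense of
   the Fourier transform U(\<beta>,t) = \<integral> e^(i\<beta>x) u(x,t) dx. *)
definition delta_solution :: "(real \<Rightarrow> real \<Rightarrow> complex) \<Rightarrow> bool" where
  "delta_solution u \<longleftrightarrow>
     (\<exists>U. fourier_problem U \<and>
        (\<forall>t>0. integrable lborel (\<lambda>x. u x t) \<and>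
           (\<forall>\<beta>. U \<beta> t = (CLINT x|lborel. iexp (\<beta> * x) * u x t))))"

definition standard_brownian_motion :: "'b measure \<Rightarrow> (real \<Rightarrow> 'b \<Rightarrow> real) \<Rightarrow> bool" where
  "standard_brownian_motion M B \<longleftrightarrow>
     prob_space M \<and>
     (\<forall>s\<ge>0. B s \<in> borel_measurable M) \<and>
     (AE \<omega> in M. B 0 \<omega> = 0) \<and>
     (\<forall>n. \<forall>\<tau>::nat \<Rightarrow> real. 0 \<le> \<tau> 0 \<and> (\<forall>i<n. \<tau> i < \<tau> (Suc i)) \<longrightarrow>
        prob_space.indep_vars M (\<lambda>_. borel) (\<lambda>i \<omega>. B (\<tau> (Suc i)) \<omega> - B (\<tau> i) \<omega>) {..<n}) \<and>
     (\<forall>r s. 0 \<le> r \<and> r < s \<longrightarrow>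
        distributed M lborel (\<lambda>\<omega>. B s \<omega> - B r \<omega>) (normal_density 0 (sqrt (s - r)))) \<and>
     (\<forall>\<omega>\<in>space M. continuous_on {0..} (\<lambda>s. B s \<omega>))"

(* Independence of the generated sigma-algebras; the library's indep_var needs both random
   variables to have the same value type. *)
definition independent_of_process :: "'b measure \<Rightarrow> ('b \<Rightarrow> real) \<Rightarrow> (real \<Rightarrow> 'b \<Rightarrow> real) \<Rightarrow> bool" where
  "independent_of_process M W B \<longleftrightarrow>
     prob_space.indep_set M
       (sets (vimage_algebra (space M) W borel))
       (sets (vimage_algebra (space M) (\<lambda>\<omega>. \<lambda>s\<in>{0..}. B s \<omega>) (PiM {0..} (\<lambda>_. borel))))"

definition W_density :: "real \<Rightarrow> real \<Rightarrow> real" where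
  "W_density t z =
     (if 0 < z then sqrt 2 * Gamma (3/4) * exp (- (z ^ 4 / (2 ^ 4 * t))) / (pi * root 4 t) else 0)"

end

theory Submission
  imports Defs
begin

text \<open>
  For the parameters (3/4, 1/3, -2/3) the Gamma quotients in the Kilbas-Saigo series telescope, because
  the numerator argument j/4 + 1/2 and the denominator argument j/4 + 5/4 = (j + 1)/4 + 1 are linked by
  Gamma (z + 1) = z Gamma z.  The function becomes E (y / 4) = (SUM k. p k y^k) with
  p k = Gamma ((k + 1) / 4) / (Gamma (1/4) k!) (lemma \<open>kilbas_saigo_series\<close>).  Reading the Gamma value as
  a moment of the weight exp (-w) w^(-3/4) and summing the exponential series under the integral gives the
  integral representation; its constant is the reflection formula at 1/4.

  The substitution w = z^4 / (16 t) turns this representation into the Laplace transform of the density of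
  W_t, evaluated at \<beta>^2 / 2 (\<open>W_density_laplace\<close>).  Since exp (- z \<beta>^2 / 2) is the characteristic function
  of a centred normal law with variance z, the function U(\<beta>, t) is the characteristic function of the
  normal variance mixture \<open>mixture_density\<close>.  The same exponential is also, up to normalisation, a normal
  density in \<beta> with variance 1/z, so one Fubini argument (\<open>gaussian_mixture_transform\<close>) yields both the
  Fourier transform of the mixture and the inversion formula that identifies the mixture with u.

  The Caputo derivative of the power series in t^(1/4) is computed term by term from Beta integrals
  (\<open>fourier_problem_ks\<close>).  For uniqueness, the Riemann-Liouville integral of order 3/4 inverts the Caputo
  derivative (\<open>caputo_inverse\<close>), so a difference D of two solutions satisfies a weakly singular Volterra
  equation; iterating it bounds |D| by a constant times the k-th term of the Kilbas-Saigo series at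
  +\<beta>^2 t^(1/4) / 4, and the terms of a convergent series tend to 0 (\<open>caputo_problem_trivial\<close>).  Uniqueness of u
  itself then follows from the injectivity of the Fourier transform on integrable functions.

  For the law of B(W_t), approximate the random time from above by the discrete times
  ceiling (n W_t) / n.  On each event where the discrete time is constant, independence factorises the
  characteristic function; path continuity passes to the limit
  (\<open>brownian_random_time_transform\<close>), and Levy's uniqueness theorem concludes.
\<close>

section \<open>Gamma and Beta integrals over Lebesgue measure\<close>

text \<open>Nonnegativity turns a gauge integral of a Borel function into an absolutely convergent Lebesgue integral;
  the Gamma and Beta integrals enter through this step.\<close>

lemma nonneg_has_integral_imp_lborel:
  fixes f :: "real \<Rightarrow> real"
  assumes f: "(f has_integral I) S" and nn: "\<And>x. x \<in> S \<Longrightarrow> 0 \<le> f x"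
    and [measurable]: "f \<in> borel_measurable borel" "S \<in> sets borel"
  shows "set_integrable lborel S f" and "(LBINT x:S. f x) = I"
proof -
  have ai: "f absolutely_integrable_on S"
    using f nn by (intro nonnegative_absolutely_integrable_1) (auto simp: integrable_on_def)
  have m: "(\<lambda>x. indicator S x *\<^sub>R f x) \<in> borel_measurable lborel"
    by measurable
  show i: "set_integrable lborel S f"
    using ai integrable_completion[OF m] unfolding set_integrable_def by simp
  have "(LBINT x:S. f x) = (LINT x:S|lebesgue. f x)"
    using integral_completion[OF m] unfolding set_lebesgue_integral_def by simp
  also have "\<dots> = integral S f"
    using ai by (rule set_lebesgue_integral_eq_integral(2))
  finally show "(LBINT x:S. f x) = I"
    using f by (simp add: integral_unique)
qed

lemma Gamma_lborel:
  fixes a :: real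
  assumes "0 < a"
  shows "set_integrable lborel {0<..} (\<lambda>w. exp (- w) * w powr (a - 1))" (is ?i)
    and "(LBINT w:{0<..}. exp (- w) * w powr (a - 1)) = Gamma a" (is ?e)
proof -
  have "((\<lambda>t. exp (- t) * t powr (a - 1)) has_integral Gamma a) {0..}"
    using Gamma_integral_real[OF assms] by (simp add: exp_minus divide_inverse mult.commute)
  note * = nonneg_has_integral_imp_lborel[OF this]
  have eq: "(\<lambda>w. indicator {0..} w *\<^sub>R (exp (- w) * w powr (a - 1))) =
      (\<lambda>w. indicator {0<..} w *\<^sub>R (exp (- w) * w powr (a - 1)))" for a :: real
    by (auto simp: indicator_def fun_eq_iff)
  show ?i ?e
    using * unfolding set_integrable_def set_lebesgue_integral_def eq by simp_all
qed

lemma Beta_lborel: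
  fixes a b t :: real
  assumes "0 < a" "0 < b" "0 < t"
  shows "set_integrable lborel {0<..<t} (\<lambda>s. (t - s) powr (a - 1) * s powr (b - 1))" (is ?i)
    and "(LBINT s:{0<..<t}. (t - s) powr (a - 1) * s powr (b - 1)) = t powr (a + b - 1) * Beta a b" (is ?e)
proof -
  let ?f = "\<lambda>s. (1 - s) powr (a - 1) * s powr (b - 1)"
  have "(?f has_integral Beta a b) {0..1}"
    using has_integral_Beta_real[OF assms(2,1)] by (simp add: mult.commute Beta_commute)
  note * = nonneg_has_integral_imp_lborel[OF this]
  have eq: "indicator {0<..<t} (t * s) *\<^sub>R ((t - t * s) powr (a - 1) * (t * s) powr (b - 1)) =
      t powr (a + b - 2) * (indicator {0..1} s *\<^sub>R ?f s)" for s
  proof (cases "0 < s \<and> s < 1")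
    case True
    have "(t - t * s) powr (a - 1) = t powr (a - 1) * (1 - s) powr (a - 1)"
      using True assms by (subst powr_mult[symmetric]) (auto simp: algebra_simps)
    moreover have "(t * s) powr (b - 1) = t powr (b - 1) * s powr (b - 1)"
      using True assms by (simp add: powr_mult)
    moreover have "t powr (a - 1) * t powr (b - 1) = t powr (a + b - 2)"
      by (simp add: powr_add[symmetric])
    ultimately show ?thesis using True assms by (simp add: indicator_def)
  next
    case False
    then have "indicator {0<..<t} (t * s) = (0::real)" "indicator {0..1} s * ?f s = 0"
      using assms by (auto simp: indicator_def zero_less_mult_iff)
    then show ?thesis by simp
  qed
  show ?i
    unfolding set_integrable_def
    apply (subst lborel_integrable_real_affine_iff[of t _ 0, symmetric])
    subgoal using assms by simp
    subgoal unfolding add_0 eq using * by (intro integrable_mult_right) (simp add: set_integrable_def)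
    done
  have "(LBINT s:{0<..<t}. (t - s) powr (a - 1) * s powr (b - 1)) = t * (t powr (a + b - 2) * Beta a b)"
    unfolding set_lebesgue_integral_def
    apply (subst lborel_integral_real_affine[of t _ 0])
    subgoal using assms by simp
    subgoal unfolding add_0 eq integral_mult_right_zero
      using assms * by (simp add: set_lebesgue_integral_def)
    done
  also have "\<dots> = t powr (a + b - 1) * Beta a b"
    using assms powr_add[of t 1 "a + b - 2"] by simp
  finally show ?e .
qed

section \<open>The Kilbas-Saigo function as a Laplace-type integral\<close>

text \<open>The telescoped form of the Kilbas-Saigo coefficients at the parameters (3/4, 1/3, -2/3), with the factor
  \<open>4 ^ k\<close> moved into the argument (see \<open>ks_prod\<close>).\<close>

definition ks_coeff :: "nat \<Rightarrow> real" where
  "ks_coeff k = Gamma ((real k + 1) / 4) / (Gamma (1/4) * fact k)"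

lemma linear_le_quartic:
  fixes s x :: real
  assumes "0 \<le> s" "0 \<le> x"
  shows "s * x \<le> x ^ 4 / 2 + s * (1 + 2 * s)"
proof (cases "x \<le> 1 + 2 * s")
  case True
  then have "s * x \<le> s * (1 + 2 * s)" using assms by (intro mult_left_mono) auto
  then show ?thesis using assms by (simp add: add_increasing)
next
  case False
  then have "x \<le> x ^ 3" using assms by (intro self_le_power) auto
  then have "2 * s \<le> x ^ 3" using False by linarith
  then have "s * x \<le> x ^ 3 / 2 * x" using assms by (intro mult_right_mono) auto
  also have "\<dots> = x ^ 4 / 2" by (simp add: eval_nat_numeral)
  finally show ?thesis using assms by (simp add: add_increasing2)
qed

lemma powr_quarter_power:
  fixes w :: real
  assumes "0 < w" shows "(w powr (1/4)) ^ k = w powr (real k / 4)"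
  using assms by (simp add: powr_powr powr_realpow[symmetric])

text \<open>Since \<open>w powr (1/4)\<close> grows more slowly than \<open>w / 2\<close>, half of the decay of \<open>exp (- w)\<close> absorbs the
  exponential factor.\<close>

lemma Gamma_weight_exp_integrable:
  fixes a s :: real
  assumes "0 < a"
  shows "set_integrable lborel {0<..} (\<lambda>w. exp (- w) * w powr (a - 1) * exp (s * w powr (1/4)))"
proof -
  \<comment> \<open>The additive constant from \<open>linear_le_quartic\<close> at \<open>x = w powr (1/4)\<close>.\<close>
  define C where "C = \<bar>s\<bar> * (1 + 2 * \<bar>s\<bar>)"
  have "integrable lborel (\<lambda>w. indicator {0<..} w *\<^sub>R (exp (- w) * w powr (a - 1)))"
    using Gamma_lborel(1)[OF assms] by (simp add: set_integrable_def)
  from lborel_integrable_real_affine[OF this, of "1/2" 0]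
  have i: "integrable lborel (\<lambda>w. exp C * 2 powr (a - 1) * (indicator {0<..} (w/2) *\<^sub>R (exp (- (w/2)) * (w/2) powr (a - 1))))"
    by (intro integrable_mult_right) simp
  show ?thesis unfolding set_integrable_def
  proof (rule Bochner_Integration.integrable_bound[OF i])
    show "AE w in lborel. norm (indicator {0<..} w *\<^sub>R (exp (- w) * w powr (a - 1) * exp (s * w powr (1 / 4))))
       \<le> norm (exp C * 2 powr (a - 1) * (indicator {0<..} (w / 2) *\<^sub>R (exp (- (w / 2)) * (w / 2) powr (a - 1))))"
    proof (rule AE_I2)
      fix w :: real
      show "norm (indicator {0<..} w *\<^sub>R (exp (- w) * w powr (a - 1) * exp (s * w powr (1 / 4))))
       \<le> norm (exp C * 2 powr (a - 1) * (indicator {0<..} (w / 2) *\<^sub>R (exp (- (w / 2)) * (w / 2) powr (a - 1))))"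
      proof (cases "0 < w")
        case True
        have "s * w powr (1/4) \<le> \<bar>s\<bar> * w powr (1/4)" by (intro mult_right_mono) auto
        also have "\<dots> \<le> (w powr (1/4)) ^ 4 / 2 + C"
          unfolding C_def by (rule linear_le_quartic) auto
        also have "(w powr (1/4)) ^ 4 = w" using True by (simp add: powr_quarter_power)
        finally have "exp (- w) * exp (s * w powr (1/4)) \<le> exp C * exp (- (w/2))"
          by (simp add: exp_add[symmetric])
        moreover have "w powr (a - 1) = 2 powr (a - 1) * (w/2) powr (a - 1)"
          using True by (simp add: powr_mult[symmetric])
        ultimately show ?thesis using True
          by (simp add: mult_ac)
      qed simp
    qed
  qed (measurable)
qed

lemma ks_coeff_nonneg: "0 \<le> ks_coeff k"
  by (simp add: ks_coeff_def less_imp_le)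

lemma ks_coeff_integral:
  shows "set_integrable lborel {0<..} (\<lambda>w. exp (- w) * w powr (-3/4) * ((r * w powr (1/4)) ^ k / fact k))" (is ?i)
    and "(LBINT w:{0<..}. exp (- w) * w powr (-3/4) * ((r * w powr (1/4)) ^ k / fact k)) =
      Gamma (1/4) * (ks_coeff k * r ^ k)" (is ?e)
proof -
  have pos: "0 < (real k + 1) / 4" by simp
  have eq: "(\<lambda>w. indicator {0<..} w *\<^sub>R (exp (- w) * w powr (-3/4) * ((r * w powr (1/4)) ^ k / fact k))) =
    (\<lambda>w. (r ^ k / fact k) * (indicator {0<..} w *\<^sub>R (exp (- w) * w powr ((real k + 1) / 4 - 1))))"
  proof
    fix w :: real
    have "w powr (-3/4) * (w powr (1/4)) ^ k = w powr ((real k + 1) / 4 - 1)" if "0 < w"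
      using that by (simp add: powr_quarter_power powr_add[symmetric] field_simps)
    then show "indicator {0<..} w *\<^sub>R (exp (- w) * w powr (-3/4) * ((r * w powr (1/4)) ^ k / fact k)) =
      (r ^ k / fact k) * (indicator {0<..} w *\<^sub>R (exp (- w) * w powr ((real k + 1) / 4 - 1)))"
      by (auto simp: indicator_def power_mult_distrib)
  qed
  show ?i using Gamma_lborel(1)[OF pos] unfolding set_integrable_def eq by (rule integrable_mult_right)
  have G: "Gamma (1/4 :: real) \<noteq> 0" using Gamma_real_pos[of "1/4"] by linarith
  show ?e using Gamma_lborel(2)[OF pos] G unfolding set_lebesgue_integral_def eq ks_coeff_def
    by simp
qed

lemma exp_sums: "(\<lambda>k. x ^ k / fact k) sums exp (x::real)"
  using exp_converges[of x] by (simp add: divide_inverse mult.commute)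

text \<open>A single term of the exponential series is at most the whole, so \<open>ks_coeff k * s ^ k\<close> is bounded in \<open>k\<close> for
  every positive \<open>s\<close>; taking \<open>s\<close> larger than twice \<open>\<bar>r\<bar>\<close> leaves a geometric series.\<close>

lemma ks_summable: "summable (\<lambda>k. ks_coeff k * r ^ k)"
proof -
  define s where "s = 2 * \<bar>r\<bar> + 1"
  define K where "K = (LBINT w:{0<..}. exp (- w) * w powr (-3/4) * exp (s * w powr (1/4)))"
  have s: "0 < s" by (simp add: s_def)
  have Gp: "0 < Gamma (1/4 :: real)" by simp
  have le: "Gamma (1/4) * (ks_coeff k * s ^ k) \<le> K" for k
    unfolding K_def ks_coeff_integral(2)[symmetric]
  proof (rule set_integral_mono)
    show "set_integrable lborel {0<..} (\<lambda>w. exp (- w) * w powr (- 3 / 4) * exp (s * w powr (1 / 4)))"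
      using Gamma_weight_exp_integrable[of "1/4" s] by simp
    fix w :: real assume "w \<in> {0<..}"
    have "sum (\<lambda>k. (s * w powr (1/4)) ^ k / fact k) {k} \<le> exp (s * w powr (1/4))"
      unfolding sums_unique[OF exp_sums]
      using s by (intro sum_le_suminf sums_summable[OF exp_sums]) auto
    then have "(s * w powr (1/4)) ^ k / fact k \<le> exp (s * w powr (1/4))" by simp
    then show "exp (- w) * w powr (- 3 / 4) * ((s * w powr (1 / 4)) ^ k / fact k) \<le>
       exp (- w) * w powr (- 3 / 4) * exp (s * w powr (1 / 4))"
      by (intro mult_left_mono) auto
  qed (rule ks_coeff_integral)
  have "summable (\<lambda>k. K / Gamma (1/4) * (\<bar>r\<bar> / s) ^ k)"
    using s by (intro summable_mult summable_geometric) (auto simp: s_def)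
  then show ?thesis
  proof (rule summable_comparison_test'[where N = 0])
    fix k
    have "ks_coeff k * s ^ k \<le> K / Gamma (1/4)" using le[of k] Gp by (simp add: field_simps)
    then have "(ks_coeff k * s ^ k) * (\<bar>r\<bar> / s) ^ k \<le> K / Gamma (1/4) * (\<bar>r\<bar> / s) ^ k"
      using s by (intro mult_right_mono) auto
    moreover have "(ks_coeff k * s ^ k) * (\<bar>r\<bar> / s) ^ k = norm (ks_coeff k * r ^ k)"
      using s ks_coeff_nonneg[of k] by (simp add: power_divide abs_mult power_abs)
    ultimately show "norm (ks_coeff k * r ^ k) \<le> K / Gamma (1/4) * (\<bar>r\<bar> / s) ^ k" by simp
  qed
qed

lemma ks_integral:
  "(\<Sum>k. ks_coeff k * r ^ k) =
    (LBINT w:{0<..}. exp (- w) * w powr (-3/4) * exp (r * w powr (1/4))) / Gamma (1/4)"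
proof -
  have Gp: "0 < Gamma (1/4 :: real)" by simp
  let ?f = "\<lambda>k w. indicator {0<..} w *\<^sub>R (exp (- w) * w powr (-3/4) * ((r * w powr (1/4)) ^ k / fact k))"
  have nf: "norm (?f k w) = indicator {0<..} w *\<^sub>R (exp (- w) * w powr (-3/4) * ((\<bar>r\<bar> * w powr (1/4)) ^ k / fact k))" for k w
    by (simp add: abs_mult power_abs indicator_def)
  have "(\<lambda>k. integral\<^sup>L lborel (?f k)) sums (LBINT w. (\<Sum>k. ?f k w))"
  proof (rule sums_integral)
    show "integrable lborel (?f k)" for k
      using ks_coeff_integral(1) by (simp add: set_integrable_def)
    show "AE w in lborel. summable (\<lambda>k. norm (?f k w))"
      by (subst nf) (simp only: real_scaleR_def, intro AE_I2 summable_mult sums_summable[OF exp_sums])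
    have "(LBINT w. norm (?f k w)) = Gamma (1/4) * (ks_coeff k * \<bar>r\<bar> ^ k)" for k
      unfolding nf using ks_coeff_integral(2) by (simp add: set_lebesgue_integral_def)
    then show "summable (\<lambda>k. LBINT w. norm (?f k w))"
      using summable_mult[OF ks_summable] by simp
  qed
  moreover have "(\<Sum>k. ?f k w) = indicator {0<..} w *\<^sub>R (exp (- w) * w powr (-3/4) * exp (r * w powr (1/4)))" for w
    unfolding real_scaleR_def
    by (intro sums_unique[symmetric] sums_mult exp_sums)
  moreover have "integral\<^sup>L lborel (?f k) = Gamma (1/4) * (ks_coeff k * r ^ k)" for k
    using ks_coeff_integral(2) by (simp add: set_lebesgue_integral_def)
  ultimately have "(\<lambda>k. Gamma (1/4) * (ks_coeff k * r ^ k)) sums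
     (LBINT w:{0<..}. exp (- w) * w powr (-3/4) * exp (r * w powr (1/4)))"
    by (simp add: set_lebesgue_integral_def)
  from sums_divide[OF this, of "Gamma (1/4)"] Gp show ?thesis
    by (intro sums_unique[symmetric]) simp
qed

lemma Gamma_plus1_pos: "0 < x \<Longrightarrow> Gamma (x + 1) = x * Gamma (x::real)"
  by (intro Gamma_plus1) (auto elim!: nonpos_Ints_cases)

lemma Gamma_pos_nonzero: "0 < x \<Longrightarrow> Gamma (x::real) \<noteq> 0"
  using Gamma_real_pos[of x] by linarith

text \<open>Each new factor has numerator \<open>Gamma ((k + 3) / 4)\<close> and denominator
  \<open>Gamma ((k + 2) / 4 + 1) = (k + 2) / 4 * Gamma ((k + 2) / 4)\<close>, and the latter Gamma value is the numerator of
  the previous factor.\<close>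

lemma ks_prod:
  "(\<Prod>j = 0..k. Gamma (3/4 * (real j * (1/3) + (-2/3)) + 1) / Gamma (3/4 * (real j * (1/3) + (-2/3) + 1) + 1))
     = 4 ^ Suc k * ks_coeff (Suc k)"
proof (induction k)
  case 0
  have e: "Gamma (5/4::real) = Gamma (1/4) / 4" using Gamma_plus1_pos[of "1/4"] by simp
  have "Gamma (1/2) / (Gamma (1/4) / 4) = 4 * Gamma (1/2) / Gamma (1/4 :: real)" by simp
  then have "Gamma (1/2) / Gamma (5/4) = 4 * Gamma (1/2) / Gamma (1/4 :: real)" unfolding e .
  then show ?case by (simp add: ks_coeff_def)
next
  case (Suc k)
  let ?x = "(real k + 2) / 4"
  have p: "0 < ?x" by simp
  have g: "Gamma ?x \<noteq> 0" using Gamma_real_pos[OF p] by linarith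
  have g1: "Gamma (?x + 1) = ?x * Gamma ?x" using p by (rule Gamma_plus1_pos)
  have ab: "3/4 * (real (Suc k) * (1/3) + (-2/3)) + 1 = (real k + 3) / 4"
    "3/4 * (real (Suc k) * (1/3) + (-2/3) + 1) + 1 = ?x + 1" by (simp_all add: field_simps)
  have e: "Gamma (3/4 * (real (Suc k) * (1/3) + (-2/3)) + 1) / Gamma (3/4 * (real (Suc k) * (1/3) + (-2/3) + 1) + 1)
    = Gamma ((real k + 3) / 4) / (?x * Gamma ?x)" unfolding ab g1 ..
  have "(real (Suc k) + 1) / 4 = ?x" "(real (Suc (Suc k)) + 1) / 4 = (real k + 3) / 4" by simp_all
  then have c: "ks_coeff (Suc k) = Gamma ?x / (Gamma (1/4) * fact (Suc k))"
    "ks_coeff (Suc (Suc k)) = Gamma ((real k + 3)/4) / (Gamma (1/4) * fact (Suc (Suc k)))"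
    unfolding ks_coeff_def by (simp_all only:)
  have fs: "fact (Suc (Suc k)) = (real k + 2) * fact (Suc k)" by (simp add: fact_Suc)
  have key: "Gamma ?x / (G * F) * (H / (?x * Gamma ?x)) = 4 * (H / (G * ((real k + 2) * F)))" for G F H :: real
    using g by (simp add: divide_simps)
  have "4 ^ Suc k * A * B = 4 ^ Suc (Suc k) * C" if "A * B = 4 * C" for A B C :: real
    using that by (simp add: mult.assoc)
  from this[OF key] show ?case
    unfolding prod.atLeast0_atMost_Suc Suc.IH e c fs .
qed

lemma ks_coeff_0: "ks_coeff 0 = 1"
  using Gamma_pos_nonzero[of "1/4"] by (simp add: ks_coeff_def)

lemma kilbas_saigo_series:
  "kilbas_saigo (3/4) (1/3) (-2/3) (z::real) = (\<Sum>k. ks_coeff k * (4 * z) ^ k)"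
proof -
  have "(\<Sum>k. ks_coeff k * (4 * z) ^ k) = (\<Sum>k. ks_coeff (Suc k) * (4 * z) ^ Suc k) + ks_coeff 0"
    using suminf_split_head[OF ks_summable, of "4 * z"] by (simp only:) simp
  then show ?thesis
    unfolding kilbas_saigo_def ks_prod by (simp add: ks_coeff_0 power_mult_distrib mult_ac)
qed

text \<open>The reflection formula at 1/4, with \<open>sin (pi / 4) = 1 / sqrt 2\<close>.\<close>

lemma Gamma_quarter: "1 / Gamma (1/4) = Gamma (3/4) / (pi * sqrt (2::real))"
proof -
  have "Gamma (1/4 :: complex) * Gamma (3/4) = of_real pi / sin (of_real pi * (1/4))"
    using Gamma_reflection_complex[of "1/4"] by simp
  also have "sin (of_real pi * (1/4)) = complex_of_real (sin (pi / 4))"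
    by (simp flip: sin_of_real)
  also have "Gamma (1/4 :: complex) * Gamma (3/4) = of_real (Gamma (1/4)) * of_real (Gamma (3/4))"
    by (simp add: Gamma_complex_of_real[symmetric])
  finally have "complex_of_real (Gamma (1/4) * Gamma (3/4)) = of_real (pi / sin (pi / 4))" by simp
  then have "Gamma (1/4) * Gamma (3/4) = pi / sin (pi / 4)" by (simp only: of_real_eq_iff)
  moreover have "pi / sin (pi / 4) = pi * (2 / sqrt 2)" by (simp add: sin_45)
  ultimately have "Gamma (1/4) * Gamma (3/4) = pi * sqrt 2" by (simp only: real_div_sqrt)
  moreover have "Gamma (1/4::real) \<noteq> 0" using Gamma_real_pos[of "1/4"] by linarith
  ultimately show ?thesis by (simp add: divide_simps mult_ac)
qed

lemma root4_eq: "0 \<le> x \<Longrightarrow> root 4 x = x powr (1/4)"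
  using root_powr_inverse[of 4 x] by simp

lemma kilbas_saigo_integral:
  assumes t: "0 < t"
  shows "set_integrable lborel {0<..} (\<lambda>w. exp (- w) * w powr (-3/4) * exp (- \<beta>\<^sup>2 * root 4 (t * w)))" (is ?i)
    and "kilbas_saigo (3/4) (1/3) (-2/3) (- (1/4) * \<beta>\<^sup>2 * t powr (1/4)) =
          Gamma (3/4) / (pi * sqrt 2) *
          (LBINT w:{0<..}. exp (- w) * w powr (-3/4) * exp (- \<beta>\<^sup>2 * root 4 (t * w)))" (is ?e)
proof -
  let ?r = "- \<beta>\<^sup>2 * t powr (1/4)"
  have eq: "indicator {0<..} w *\<^sub>R (exp (- w) * w powr (-3/4) * exp (- \<beta>\<^sup>2 * root 4 (t * w))) =
    indicator {0<..} w *\<^sub>R (exp (- w) * w powr (-3/4) * exp (?r * w powr (1/4)))" for w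
    using t by (auto simp: indicator_def root4_eq powr_mult)
  show ?i using Gamma_weight_exp_integrable[of "1/4" ?r] unfolding set_integrable_def eq by simp
  have "kilbas_saigo (3/4) (1/3) (-2/3) (- (1/4) * \<beta>\<^sup>2 * t powr (1/4)) = (\<Sum>k. ks_coeff k * ?r ^ k)"
    unfolding kilbas_saigo_series by simp
  also have "\<dots> = 1 / Gamma (1/4) * (LBINT w:{0<..}. exp (- w) * w powr (-3/4) * exp (?r * w powr (1/4)))"
    unfolding ks_integral by simp
  finally show ?e
    unfolding Gamma_quarter set_lebesgue_integral_def eq .
qed

section \<open>The mixing density and its Gaussian mixture\<close>

lemma char_normal_density:
  assumes s: "0 < \<sigma>"
  shows "(CLINT x|lborel. iexp (\<xi> * x) * of_real (normal_density 0 \<sigma> x)) = of_real (exp (- (\<sigma>\<^sup>2 * \<xi>\<^sup>2 / 2)))"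
proof -
  have nd: "normal_density 0 \<sigma> (\<sigma> * x) = std_normal_density x / \<sigma>" for x
    using s by (simp add: normal_density_def real_sqrt_mult power_mult_distrib)
  have "(CLINT x|lborel. iexp (\<xi> * x) * of_real (normal_density 0 \<sigma> x)) =
      \<sigma> *\<^sub>R (CLINT x|lborel. iexp (\<xi> * (\<sigma> * x)) * of_real (normal_density 0 \<sigma> (\<sigma> * x)))"
    using s by (subst lborel_integral_real_affine[of \<sigma> _ 0]) simp_all
  also have "\<dots> = (CLINT x|lborel. \<sigma> *\<^sub>R (iexp (\<xi> * (\<sigma> * x)) * of_real (normal_density 0 \<sigma> (\<sigma> * x))))"
    by simp
  also have "\<dots> = (CLINT x|lborel. std_normal_density x *\<^sub>R iexp ((\<sigma> * \<xi>) * x))"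
    using s unfolding nd by (intro Bochner_Integration.integral_cong) (auto simp: scaleR_conv_of_real mult_ac)
  also have "\<dots> = char std_normal_distribution (\<sigma> * \<xi>)"
    unfolding char_def by (subst integral_density) auto
  also have "\<dots> = of_real (exp (- (\<sigma>\<^sup>2 * \<xi>\<^sup>2 / 2)))"
    by (simp add: char_std_normal_distribution power_mult_distrib)
  finally show ?thesis .
qed

text \<open>This is used twice with different readings of the Gaussian: with \<open>s = sqrt\<close> the normal density is that of
  Brownian motion in the space variable, and with \<open>s z = 1 / sqrt z\<close> it is the Laplace kernel
  \<open>exp (- z * \<beta>\<^sup>2 / 2)\<close> as a function of the frequency.\<close>

lemma gaussian_mixture_transform:
  fixes w s :: "real \<Rightarrow> real"
  assumes w: "integrable lborel w" and s [measurable]: "s \<in> borel_measurable borel"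
    and pos: "\<And>z. w z \<noteq> 0 \<Longrightarrow> 0 < s z"
  shows "complex_integrable lborel (\<lambda>x. iexp (\<xi> * x) * of_real (LBINT z. w z * normal_density 0 (s z) x))" (is ?i)
    and "(CLINT x|lborel. iexp (\<xi> * x) * of_real (LBINT z. w z * normal_density 0 (s z) x)) =
      of_real (LBINT z. w z * exp (- ((s z)\<^sup>2 * \<xi>\<^sup>2 / 2)))" (is ?e)
proof -
  have [measurable]: "w \<in> borel_measurable borel" using w by auto
  have nd[measurable]: "(\<lambda>(z, x). normal_density 0 (s z) x) \<in> borel_measurable (lborel \<Otimes>\<^sub>M lborel)"
    unfolding normal_density_def by measurable
  let ?f = "\<lambda>z x. iexp (\<xi> * x) * complex_of_real (w z * normal_density 0 (s z) x)"
  have norm_f: "norm (?f z x) = \<bar>w z\<bar> * normal_density 0 (s z) x" for z x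
    by (simp add: norm_mult abs_mult)
  have int: "integrable (lborel \<Otimes>\<^sub>M lborel) (case_prod ?f)"
  proof (rule lborel_pair.Fubini_integrable)
    show "case_prod ?f \<in> borel_measurable (lborel \<Otimes>\<^sub>M lborel)"
      using nd by (measurable; simp add: split_beta)
    have "(LBINT y. norm (case_prod ?f (x, y))) = \<bar>w x\<bar>" for x
      using pos[of x] unfolding prod.case norm_f by (cases "w x = 0") auto
    then show "integrable lborel (\<lambda>x. LBINT y. norm (case_prod ?f (x, y)))"
      using w by simp
    show "AE x in lborel. complex_integrable lborel (\<lambda>y. case_prod ?f (x, y))"
    proof (rule AE_I2)
      fix x
      show "complex_integrable lborel (\<lambda>y. case_prod ?f (x, y))"
      proof (cases "w x = 0")
        case False
        have "integrable lborel (\<lambda>y. \<bar>w x\<bar> * normal_density 0 (s x) y)"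
          using pos[OF False] by (intro integrable_mult_right integrable_normal_density)
        then show ?thesis
          by (rule Bochner_Integration.integrable_bound) (auto simp: norm_f simp del: of_real_mult)
      qed simp
    qed
  qed
  have in_z: "(CLINT z|lborel. ?f z x) = iexp (\<xi> * x) * of_real (LBINT z. w z * normal_density 0 (s z) x)" for x
    unfolding integral_mult_right_zero integral_complex_of_real ..
  have in_x: "(CLINT x|lborel. ?f z x) = of_real (w z * exp (- ((s z)\<^sup>2 * \<xi>\<^sup>2 / 2)))" for z
  proof (cases "w z = 0")
    case False
    have "(CLINT x|lborel. ?f z x) = of_real (w z) * (CLINT x|lborel. iexp (\<xi> * x) * of_real (normal_density 0 (s z) x))"
      by (simp flip: integral_mult_right_zero) (simp add: mult_ac)
    then show ?thesis unfolding char_normal_density[OF pos[OF False]] by simp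
  qed simp
  show ?i
    using lborel_pair.integrable_snd[OF int] unfolding in_z .
  show ?e
    using lborel_pair.Fubini_integral[OF int] unfolding in_z in_x integral_complex_of_real .
qed

lemma W_density_measurable [measurable]: "W_density t \<in> borel_measurable borel"
  unfolding W_density_def by measurable

lemma W_density_nonneg: "0 < t \<Longrightarrow> 0 \<le> W_density t z"
  by (auto simp: W_density_def less_imp_le)

text \<open>The substitution \<open>w = z ^ 4 / (16 * t)\<close> maps the weight \<open>exp (- w) * w powr (-3/4)\<close> to a multiple of the density
  of \<open>W\<^sub>t\<close>: the powers of \<open>z\<close> in the weight and in the Jacobian cancel.\<close>

lemma W_density_substitution:
  assumes t: "0 < t" and [measurable]: "h \<in> borel_measurable borel"
    and int: "set_integrable lborel {0<..} (\<lambda>w. exp (- w) * w powr (-3/4) * h w)"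
  shows "integrable lborel (\<lambda>z. W_density t z * h (z ^ 4 / (2 ^ 4 * t)))" (is ?i)
    and "(LBINT z. W_density t z * h (z ^ 4 / (2 ^ 4 * t))) =
      Gamma (3/4) / (pi * sqrt 2) * (LBINT w:{0<..}. exp (- w) * w powr (-3/4) * h w)" (is ?e)
proof -
  let ?f = "\<lambda>w. exp (- w) * w powr (-3/4) * h w"
  let ?S = "{0<..} :: real set"
  define g where "g z = z ^ 4 / (2 ^ 4 * t)" for z :: real
  define g' where "g' z = z ^ 3 / (4 * t)" for z :: real
  have [measurable]: "g \<in> borel_measurable borel" "g' \<in> borel_measurable borel"
    unfolding g_def g'_def by measurable
  have img: "g ` ?S = ?S"
  proof safe
    fix w :: real assume w: "0 < w"
    have "(root 4 (2 ^ 4 * t * w)) ^ 4 = 2 ^ 4 * t * w"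
      using t w by (intro real_root_pow_pos2) auto
    then have "w = g (root 4 (2 ^ 4 * t * w))"
      using t by (simp add: g_def)
    moreover have "root 4 (2 ^ 4 * t * w) \<in> ?S" using t w by simp
    ultimately show "w \<in> g ` ?S" by blast
  qed (use t in \<open>simp add: g_def\<close>)
  have inj: "inj_on g ?S"
    using t by (auto simp: inj_on_def g_def dest!: power_eq_imp_eq_base)
  have der: "(g has_field_derivative g' z) (at z within ?S)" for z
    unfolding g_def g'_def using t
    by (auto intro!: derivative_eq_intros simp: field_simps eval_nat_numeral)
  have mf: "(\<lambda>w. indicator ?S w *\<^sub>R ?f w) \<in> borel_measurable lborel" by measurable
  have mg: "(\<lambda>z. indicator ?S z *\<^sub>R (\<bar>g' z\<bar> * ?f (g z))) \<in> borel_measurable lborel" by measurable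
  have ai: "?f absolutely_integrable_on ?S"
    using int integrable_completion[OF mf] unfolding set_integrable_def by simp
  have If: "integral ?S ?f = (LBINT w:?S. ?f w)"
    using set_lebesgue_integral_eq_integral(2)[OF ai] integral_completion[OF mf]
    unfolding set_lebesgue_integral_def by simp
  have "(\<lambda>z. \<bar>g' z\<bar> * ?f (g z)) absolutely_integrable_on ?S \<and>
      integral ?S (\<lambda>z. \<bar>g' z\<bar> * ?f (g z)) = (LBINT w:?S. ?f w)"
    using has_absolute_integral_change_of_variables_1'[OF _ der inj, of ?f "LBINT w:?S. ?f w"] ai If img
    by simp
  then have ag: "(\<lambda>z. \<bar>g' z\<bar> * ?f (g z)) absolutely_integrable_on ?S"
    and Ig: "integral ?S (\<lambda>z. \<bar>g' z\<bar> * ?f (g z)) = (LBINT w:?S. ?f w)" by auto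
  have ig: "integrable lborel (\<lambda>z. indicator ?S z *\<^sub>R (\<bar>g' z\<bar> * ?f (g z)))"
    using ag integrable_completion[OF mg] unfolding set_integrable_def by simp
  have Igl: "(LBINT z. indicator ?S z *\<^sub>R (\<bar>g' z\<bar> * ?f (g z))) = (LBINT w:?S. ?f w)"
    using set_lebesgue_integral_eq_integral(2)[OF ag] integral_completion[OF mg] Ig
    unfolding set_lebesgue_integral_def by simp
  \<comment> \<open>The powers of \<open>z\<close> cancel, since \<open>(z ^ 4) powr (-3/4)\<close> is the inverse of \<open>z ^ 3\<close>.\<close>
  have jac: "g' z * g z powr (-3/4) = 2 / root 4 t" if z: "0 < z" for z
  proof -
    have q: "(x ^ 4) powr (-3/4) = x powr (-3)" if "0 < x" for x :: real
      using that by (subst powr_numeral[symmetric]) (simp_all add: powr_powr del: powr_numeral)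
    have "g z powr (-3/4) = (z ^ 4) powr (-3/4) / ((2 ^ 4) powr (-3/4) * t powr (-3/4))"
      using z t unfolding g_def by (subst powr_divide) (auto simp only: powr_mult)
    also have "\<dots> = z powr (-3) / (2 powr (-3) * t powr (-3/4))"
      using z by (subst (1 2) q) auto
    finally have "g' z * g z powr (-3/4) = z powr 3 / (4 * t) * (z powr (-3) / (2 powr (-3) * t powr (-3/4)))"
      using z by (simp add: g'_def)
    also have "\<dots> = (z powr 3 * z powr (-3)) * (2 / (t powr 1 * t powr (-3/4)))"
      using t by (simp add: field_simps powr_minus)
    also have "\<dots> = 2 / t powr (1/4)"
      using z t by (simp only: powr_add[symmetric]) simp
    finally show ?thesis using t by (simp add: root4_eq)
  qed
  have eq: "W_density t z * h (z ^ 4 / (2 ^ 4 * t)) =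
      Gamma (3/4) / (pi * sqrt 2) * (indicator ?S z *\<^sub>R (\<bar>g' z\<bar> * ?f (g z)))" for z
  proof (cases "0 < z")
    case True
    have f: "\<bar>g' z\<bar> * ?f (g z) = (g' z * g z powr (-3/4)) * (exp (- g z) * h (g z))"
      using True t by (simp add: g'_def)
    have "2 / sqrt 2 * G * E / (pi * R) * H = G / (pi * sqrt 2) * (2 / R * (E * H))" for G E R H :: real
      by (simp add: mult_ac)
    then have "sqrt 2 * G * E / (pi * R) * H = G / (pi * sqrt 2) * (2 / R * (E * H))" for G E R H :: real
      by (simp only: real_div_sqrt)
    then show ?thesis
      using True unfolding W_density_def g_def[symmetric] f jac[OF True] by simp
  qed (simp add: W_density_def)
  show ?i unfolding eq by (intro integrable_mult_right ig)
  show ?e unfolding eq integral_mult_right_zero Igl ..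
qed

lemma W_density_laplace:
  assumes t: "0 < t"
  shows "integrable lborel (\<lambda>z. W_density t z * exp (- (z * \<beta>\<^sup>2 / 2)))"
    and "(LBINT z. W_density t z * exp (- (z * \<beta>\<^sup>2 / 2))) =
      kilbas_saigo (3/4) (1/3) (-2/3) (- (1/4) * \<beta>\<^sup>2 * t powr (1/4))"
proof -
  have eq: "W_density t z * exp (- \<beta>\<^sup>2 * root 4 (t * (z ^ 4 / (2 ^ 4 * t)))) = W_density t z * exp (- (z * \<beta>\<^sup>2 / 2))" for z
  proof (cases "0 < z")
    case True
    have "t * (z ^ 4 / (2 ^ 4 * t)) = (z / 2) ^ 4" using t by (simp add: power_divide)
    then have "root 4 (t * (z ^ 4 / (2 ^ 4 * t))) = z / 2"
      using True by (simp only: real_root_pos2)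
    then show ?thesis by (simp add: mult_ac)
  qed (simp add: W_density_def)
  note * = W_density_substitution[OF t _ kilbas_saigo_integral(1)[OF t, of \<beta>]]
  show "integrable lborel (\<lambda>z. W_density t z * exp (- (z * \<beta>\<^sup>2 / 2)))"
    using *(1) unfolding eq by simp
  show "(LBINT z. W_density t z * exp (- (z * \<beta>\<^sup>2 / 2))) =
      kilbas_saigo (3/4) (1/3) (-2/3) (- (1/4) * \<beta>\<^sup>2 * t powr (1/4))"
    using *(2) unfolding eq kilbas_saigo_integral(2)[OF t] by simp
qed

lemma W_density_integrable: "0 < t \<Longrightarrow> integrable lborel (W_density t)"
  and W_density_integral: "0 < t \<Longrightarrow> (LBINT z. W_density t z) = 1"
  using W_density_laplace[of t 0] by (simp_all add: kilbas_saigo_def)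

text \<open>Up to constants, the moment of order -1/2 of \<open>W\<^sub>t\<close> is the total mass of \<open>U\<close> in the frequency variable, and it
  bounds the mixture uniformly in \<open>x\<close>, including \<open>x = 0\<close>.\<close>

lemma W_density_rsqrt_integrable:
  assumes t: "0 < t" shows "integrable lborel (\<lambda>z. W_density t z / sqrt z)"
proof -
  have "set_integrable lborel {0<..} (\<lambda>w. exp (- w) * w powr (1/8 - 1 :: real))"
    by (rule Gamma_lborel) simp
  then have "set_integrable lborel {0<..} (\<lambda>w. exp (- w) * w powr (-3/4 :: real) * w powr (-1/8 :: real))"
    by (simp add: mult.assoc powr_add[symmetric])
  from W_density_substitution(1)[OF t _ this]
  have i: "integrable lborel (\<lambda>z. (16 * t) powr (-1/8) * (W_density t z * (z ^ 4 / (2 ^ 4 * t)) powr (-1/8)))"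
    by (intro integrable_mult_right) simp
  have eq: "(16 * t) powr (-1/8) * (W_density t z * (z ^ 4 / (2 ^ 4 * t)) powr (-1/8)) = W_density t z / sqrt z" for z
  proof (cases "0 < z")
    case True
    have "(16 * t) powr (-1/8) * (z ^ 4 / (2 ^ 4 * t)) powr (-1/8) = (z powr 4) powr (-1/8)"
      using True t by (simp add: powr_mult[symmetric])
    also have "\<dots> = z powr (- (1/2))" by (simp only: powr_powr) simp
    also have "\<dots> = 1 / sqrt z" using True by (simp only: powr_minus_divide powr_half_sqrt less_imp_le)
    finally show ?thesis by (simp add: mult_ac)
  qed (simp add: W_density_def)
  show ?thesis using i unfolding eq .
qed

text \<open>The density of \<open>B(W\<^sub>t)\<close>, which turns out to be \<open>u(x, t)\<close>.\<close>

definition mixture_density :: "real \<Rightarrow> real \<Rightarrow> real" where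
  "mixture_density t x = (LBINT z. W_density t z * normal_density 0 (sqrt z) x)"

lemma mixture_density_transform:
  assumes t: "0 < t"
  shows "complex_integrable lborel (\<lambda>x. iexp (\<beta> * x) * of_real (mixture_density t x))"
    and "(CLINT x|lborel. iexp (\<beta> * x) * of_real (mixture_density t x)) =
      of_real (kilbas_saigo (3/4) (1/3) (-2/3) (- (1/4) * \<beta>\<^sup>2 * t powr (1/4)))"
proof -
  have pos: "0 < sqrt z" if "W_density t z \<noteq> 0" for z
    using that by (auto simp: W_density_def split: if_splits)
  have eq: "W_density t z * exp (- ((sqrt z)\<^sup>2 * \<beta>\<^sup>2 / 2)) = W_density t z * exp (- (z * \<beta>\<^sup>2 / 2))" for z
    by (auto simp: W_density_def)
  note * = gaussian_mixture_transform[where s = sqrt, OF W_density_integrable[OF t] _ pos, of \<beta>]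
  show "complex_integrable lborel (\<lambda>x. iexp (\<beta> * x) * of_real (mixture_density t x))"
    using *(1) by (simp add: mixture_density_def)
  show "(CLINT x|lborel. iexp (\<beta> * x) * of_real (mixture_density t x)) =
      of_real (kilbas_saigo (3/4) (1/3) (-2/3) (- (1/4) * \<beta>\<^sup>2 * t powr (1/4)))"
    using *(2) unfolding eq W_density_laplace(2)[OF t] by (simp add: mixture_density_def)
qed

text \<open>For fixed \<open>z\<close>, \<open>exp (- z * \<beta>\<^sup>2 / 2)\<close> is \<open>sqrt (2 * pi / z)\<close> times the normal density in \<open>\<beta>\<close> with variance
  \<open>1 / z\<close>.  Hence \<open>U\<close> is itself a Gaussian mixture, and its transform is again an instance of
  \<open>gaussian_mixture_transform\<close>.\<close>

lemma mixture_density_inversion: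
  assumes t: "0 < t"
  defines "U \<equiv> \<lambda>\<beta>. kilbas_saigo (3/4) (1/3) (-2/3) (- (1/4) * \<beta>\<^sup>2 * t powr (1/4))"
  shows "complex_integrable lborel (\<lambda>\<beta>. iexp (\<xi> * \<beta>) * of_real (U \<beta>))"
    and "(CLINT \<beta>|lborel. iexp (\<xi> * \<beta>) * of_real (U \<beta>)) = of_real (2 * pi * mixture_density t \<xi>)"
proof -
  define w where "w z = sqrt (2 * pi) * (W_density t z / sqrt z)" for z
  define s where "s z = 1 / sqrt z" for z :: real
  have w: "integrable lborel w"
    unfolding w_def using W_density_rsqrt_integrable[OF t] by (rule integrable_mult_right)
  have s [measurable]: "s \<in> borel_measurable borel" unfolding s_def by measurable
  have pos: "0 < s z" if "w z \<noteq> 0" for z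
    using that by (auto simp: W_density_def w_def s_def split: if_splits)
  have n1: "w z * normal_density 0 (s z) \<beta> = W_density t z * exp (- (z * \<beta>\<^sup>2 / 2))" for z \<beta>
  proof (cases "0 < z")
    case True
    then have "sqrt (2 * pi * (s z)\<^sup>2) = sqrt (2 * pi) / sqrt z"
      by (simp add: s_def real_sqrt_divide power_divide)
    then show ?thesis using True
      by (simp add: normal_density_def w_def) (simp add: s_def power_divide mult_ac)
  qed (simp add: W_density_def w_def)
  have n2: "w z * exp (- ((s z)\<^sup>2 * \<xi>\<^sup>2 / 2)) = 2 * pi * (W_density t z * normal_density 0 (sqrt z) \<xi>)" for z
  proof (cases "0 < z")
    case True
    have "sqrt (2 * pi) / sqrt z = 2 * pi / sqrt (2 * pi * z)"
      using True by (simp add: real_sqrt_mult real_div_sqrt field_simps)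
    moreover have "w z = sqrt (2 * pi) / sqrt z * W_density t z" by (simp add: w_def)
    ultimately show ?thesis using True
      by (simp add: normal_density_def s_def power_divide mult_ac)
  qed (simp add: W_density_def w_def)
  note * = gaussian_mixture_transform[OF w s pos, of \<xi>, unfolded n1 n2 W_density_laplace(2)[OF t]]
  show "complex_integrable lborel (\<lambda>\<beta>. iexp (\<xi> * \<beta>) * of_real (U \<beta>))"
    using *(1) unfolding U_def by simp
  show "(CLINT \<beta>|lborel. iexp (\<xi> * \<beta>) * of_real (U \<beta>)) = of_real (2 * pi * mixture_density t \<xi>)"
    using *(2) unfolding U_def mixture_density_def by simp
qed

lemma mixture_density_eq:
  assumes t: "0 < t"
  shows "set_integrable lborel {0<..} (\<lambda>w. exp (- (x\<^sup>2 / (2 * w))) / sqrt (2 * pi * w) * exp (- (w ^ 4 / (2 ^ 4 * t))))" (is ?i)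
    and "mixture_density t x = sqrt 2 * Gamma (3/4) / (pi * root 4 t) *
          (LBINT w:{0<..}. exp (- (x\<^sup>2 / (2 * w))) / sqrt (2 * pi * w) * exp (- (w ^ 4 / (2 ^ 4 * t))))" (is ?e)
proof -
  define c where "c = sqrt 2 * Gamma (3/4) / (pi * root 4 t)"
  define g where "g w = indicator {0<..} w *\<^sub>R (exp (- (x\<^sup>2 / (2 * w))) / sqrt (2 * pi * w) * exp (- (w ^ 4 / (2 ^ 4 * t))))" for w
  have c: "0 < c" unfolding c_def using t by (intro divide_pos_pos mult_pos_pos) auto
  have W: "W_density t z = c * exp (- (z ^ 4 / (2 ^ 4 * t)))" if "0 < z" for z
    using that by (simp add: W_density_def c_def)
  have eq: "W_density t z * normal_density 0 (sqrt z) x = c * g z" for z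
  proof (cases "0 < z")
    case True
    then show ?thesis by (simp add: W g_def normal_density_def)
  qed (simp add: W_density_def g_def)
  have [measurable]: "g \<in> borel_measurable borel" unfolding g_def by measurable
  have "integrable lborel (\<lambda>z. (1 / c / sqrt (2 * pi)) * (W_density t z / sqrt z))"
    using W_density_rsqrt_integrable[OF t] by (rule integrable_mult_right)
  then have "integrable lborel g"
  proof (rule Bochner_Integration.integrable_bound)
    show "AE z in lborel. norm (g z) \<le> norm ((1 / c / sqrt (2 * pi)) * (W_density t z / sqrt z))"
    proof (rule AE_I2)
      fix z :: real
      show "norm (g z) \<le> norm ((1 / c / sqrt (2 * pi)) * (W_density t z / sqrt z))"
      proof (cases "0 < z")
        case True
        have e: "(1 / c / sqrt (2 * pi)) * (W_density t z / sqrt z) = 1 / sqrt (2 * pi * z) * exp (- (z ^ 4 / (2 ^ 4 * t)))"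
          unfolding W[OF True] using c by (simp add: real_sqrt_mult)
        have "norm (g z) = exp (- (x\<^sup>2 / (2 * z))) / sqrt (2 * pi * z) * exp (- (z ^ 4 / (2 ^ 4 * t)))"
          using True by (simp add: g_def)
        also have "\<dots> \<le> 1 / sqrt (2 * pi * z) * exp (- (z ^ 4 / (2 ^ 4 * t)))"
          using True by (intro mult_right_mono divide_right_mono) auto
        also have "\<dots> \<le> norm (1 / sqrt (2 * pi * z) * exp (- (z ^ 4 / (2 ^ 4 * t))))"
          by (simp only: real_norm_def abs_ge_self)
        finally show ?thesis unfolding e .
      qed (simp add: g_def)
    qed
  qed simp
  then show ?i unfolding set_integrable_def g_def .
  show ?e
    unfolding mixture_density_def eq integral_mult_right_zero set_lebesgue_integral_def
    unfolding c_def g_def ..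
qed

lemma mixture_density_nonneg: "0 < t \<Longrightarrow> 0 \<le> mixture_density t x"
  unfolding mixture_density_def by (intro integral_nonneg_AE AE_I2 mult_nonneg_nonneg W_density_nonneg) auto

lemma mixture_density_integrable:
  assumes t: "0 < t"
  shows "integrable lborel (mixture_density t)" and "(LBINT x. mixture_density t x) = 1"
  using mixture_density_transform[OF t, of 0]
  by (simp_all add: kilbas_saigo_def complex_of_real_integrable_eq)

section \<open>The Caputo problem on the Fourier side\<close>

lemma Beta_pos_eq: "0 < a \<Longrightarrow> 0 < b \<Longrightarrow> Beta a b = Gamma a * Gamma b / Gamma (a + b :: real)"
  by (simp add: Beta_def)

text \<open>The coefficient identity behind the Caputo derivative of order 3/4: it sends the term of degree \<open>Suc k\<close> in
  \<open>t powr (1/4)\<close> to \<open>t powr (-1/2)\<close> times the term of degree \<open>k\<close>, up to the factor \<open>c / 4\<close>.\<close>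

lemma ks_coeff_differentiate:
  "real (Suc k) * ks_coeff (Suc k) * Beta (1/4) ((real k + 1) / 4) = Gamma (1/4) * ks_coeff k"
proof -
  have a: "1/4 + (real k + 1) / 4 = (real (Suc k) + 1) / 4" by simp
  have B: "Beta (1/4) ((real k + 1) / 4) = Gamma (1/4) * Gamma ((real k + 1) / 4) / Gamma (1/4 + (real k + 1) / 4)"
    by (rule Beta_pos_eq) auto
  have cancel: "N * (x / (g * (N * F))) * (g * y / x) = g * (y / (g * F))"
    if "x \<noteq> 0" "g \<noteq> 0" "N \<noteq> 0" for x y g N F :: real
    using that by simp
  show ?thesis
    unfolding B ks_coeff_def a fact_Suc by (intro cancel Gamma_pos_nonzero) simp_all
qed

text \<open>The inverse step, for the fractional integral of order 3/4: it drives the iteration in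
  \<open>caputo_problem_trivial\<close>.\<close>

lemma ks_coeff_integrate:
  "1/4 / Gamma (3/4) * ks_coeff k * Beta (3/4) ((real k + 2) / 4) = ks_coeff (Suc k)"
proof -
  have a: "3/4 + (real k + 2) / 4 = (real k + 1) / 4 + 1" by (simp add: field_simps)
  have b: "(real (Suc k) + 1) / 4 = (real k + 2) / 4" by simp
  have c: "real (Suc k) = real k + 1" by simp
  have g1: "Gamma ((real k + 1) / 4 + 1) = (real k + 1) / 4 * Gamma ((real k + 1) / 4)"
    by (rule Gamma_plus1_pos) simp
  have B: "Beta (3/4) ((real k + 2) / 4) = Gamma (3/4) * Gamma ((real k + 2) / 4) / Gamma (3/4 + (real k + 2) / 4)"
    by (rule Beta_pos_eq) auto
  have cancel: "1/4 / h * (x / (g * F)) * (h * y / (N / 4 * x)) = y / (g * (N * F))"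
    if "x \<noteq> 0" "h \<noteq> 0" for x y g h N F :: real
    using that by (simp add: mult_ac)
  show ?thesis
    unfolding B ks_coeff_def b a g1 fact_Suc unfolding c by (intro cancel Gamma_pos_nonzero) simp_all
qed

definition ks_fun :: "real \<Rightarrow> real" where
  "ks_fun y = (\<Sum>k. ks_coeff k * y ^ k)"

definition ks_deriv :: "real \<Rightarrow> real" where
  "ks_deriv y = (\<Sum>k. diffs ks_coeff k * y ^ k)"

lemma ks_fun_DERIV: "(ks_fun has_field_derivative ks_deriv y) (at y)"
  unfolding ks_fun_def ks_deriv_def
  by (rule termdiffs_strong_converges_everywhere) (rule ks_summable)

lemma ks_fun_powr_deriv:
  assumes "0 < s"
  shows "((\<lambda>s. complex_of_real (ks_fun (c * s powr (1/4)))) has_vector_derivative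
     of_real (c / 4 * s powr (-3/4) * ks_deriv (c * s powr (1/4)))) (at s)"
proof -
  have "((\<lambda>s. c * s powr (1/4)) has_field_derivative c * (1/4 * s powr (1/4 - 1))) (at s)"
    using assms by (auto intro!: derivative_eq_intros)
  from DERIV_chain2[OF ks_fun_DERIV this]
  have "((\<lambda>s. ks_fun (c * s powr (1/4))) has_field_derivative
      c / 4 * s powr (-3/4) * ks_deriv (c * s powr (1/4))) (at s)"
    by (simp add: mult_ac)
  then show ?thesis
    by (intro has_vector_derivative_of_real) (simp add: has_real_derivative_iff_has_vector_derivative)
qed

text \<open>Differentiating \<open>ks_fun (c * s powr (1/4))\<close> and expanding gives Beta integrands with nonnegative coefficients
  up to powers of \<open>c\<close>; the integrated norms therefore form the same series with \<open>\<bar>c\<bar>\<close> in place of \<open>c\<close>, which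
  justifies the exchange of sum and integral.\<close>

lemma ks_caputo_integral:
  assumes t: "0 < t"
  shows "set_integrable lborel {0<..<t} (\<lambda>s. (t - s) powr (-3/4) * (c / 4 * s powr (-3/4) * ks_deriv (c * s powr (1/4))))" (is ?i)
    and "(LBINT s:{0<..<t}. (t - s) powr (-3/4) * (c / 4 * s powr (-3/4) * ks_deriv (c * s powr (1/4)))) =
      Gamma (1/4) * (c / 4 * t powr (-1/2) * ks_fun (c * t powr (1/4)))" (is ?e)
proof -
  define b where "b c k s = indicator {0<..<t} s *\<^sub>R
     (c ^ Suc k / 4 * (real (Suc k) * ks_coeff (Suc k)) * ((t - s) powr (1/4 - 1) * s powr ((real k + 1) / 4 - 1)))"
    for c :: real and k s
  define I where "I c k = Gamma (1/4) * (c / 4 * t powr (-1/2) * (ks_coeff k * (c * t powr (1/4)) ^ k))" for c :: real and k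
  have kp: "0 < (real k + 1) / 4" for k by simp
  note B = Beta_lborel[OF _ kp t, of "1/4"]
  have b_eq: "b c k s = (c ^ Suc k / 4 * (real (Suc k) * ks_coeff (Suc k))) *
     (indicator {0<..<t} s *\<^sub>R ((t - s) powr (1/4 - 1) * s powr ((real k + 1) / 4 - 1)))" for c k s
    by (simp add: b_def)
  have b_int: "integrable lborel (b c k)" for c k
    unfolding b_eq using B(1) by (intro integrable_mult_right) (simp add: set_integrable_def)
  have b_I: "(LBINT s. b c k s) = I c k" for c k
  proof -
    have "(LBINT s. b c k s) = (c ^ Suc k / 4 * (real (Suc k) * ks_coeff (Suc k))) *
        (t powr (1/4 + (real k + 1) / 4 - 1) * Beta (1/4) ((real k + 1) / 4))"
      unfolding b_eq integral_mult_right_zero using B(2) by (simp add: set_lebesgue_integral_def)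
    also have "\<dots> = c ^ Suc k / 4 * t powr (1/4 + (real k + 1) / 4 - 1) *
       (real (Suc k) * ks_coeff (Suc k) * Beta (1/4) ((real k + 1) / 4))"
      by (simp only: mult_ac)
    also have "t powr (1/4 + (real k + 1) / 4 - 1) = t powr (-1/2) * (t powr (1/4)) ^ k"
      using t by (simp add: powr_quarter_power powr_add[symmetric] field_simps)
    finally show ?thesis
      unfolding ks_coeff_differentiate I_def by (simp add: power_mult_distrib mult_ac)
  qed
  have b_sums: "b c k s = indicator {0<..<t} s *\<^sub>R ((t - s) powr (-3/4) * (c / 4 * s powr (-3/4))) *
      (diffs ks_coeff k * (c * s powr (1/4)) ^ k)" for c k s
  proof (cases "s \<in> {0<..<t}")
    case True
    then have "s powr ((real k + 1) / 4 - 1) = s powr (-3/4) * (s powr (1/4)) ^ k"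
      by (simp add: powr_quarter_power powr_add[symmetric] field_simps)
    then show ?thesis
      by (simp add: b_def diffs_def power_mult_distrib mult_ac)
  qed (simp add: b_def)
  have summ: "summable (\<lambda>k. diffs ks_coeff k * y ^ k)" for y
    by (rule termdiff_converges_all) (rule ks_summable)
  have nb: "norm (b c k s) = b \<bar>c\<bar> k s" for k s
    by (simp add: b_def abs_mult power_abs ks_coeff_nonneg indicator_def)
  have "summable (\<lambda>k. b \<bar>c\<bar> k s)" for s
    unfolding b_sums by (intro summable_mult summ)
  then have "AE s in lborel. summable (\<lambda>k. norm (b c k s))"
    unfolding nb by simp
  moreover have "summable (\<lambda>k. LBINT s. norm (b c k s))"
    unfolding nb b_I I_def by (intro summable_mult ks_summable)
  ultimately have *: "integrable lborel (\<lambda>s. \<Sum>k. b c k s)" "(\<lambda>k. LBINT s. b c k s) sums (LBINT s. \<Sum>k. b c k s)"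
    using b_int by (auto intro!: integrable_suminf sums_integral)
  have sb: "(\<Sum>k. b c k s) = indicator {0<..<t} s *\<^sub>R ((t - s) powr (-3/4) * (c / 4 * s powr (-3/4) * ks_deriv (c * s powr (1/4))))" for s
    unfolding b_sums by (subst suminf_mult[OF summ]) (simp add: ks_deriv_def mult_ac)
  show ?i using *(1) unfolding sb set_integrable_def .
  have "(\<lambda>k. I c k) sums (Gamma (1/4) * (c / 4 * t powr (-1/2) * ks_fun (c * t powr (1/4))))"
    unfolding I_def ks_fun_def by (intro sums_mult summable_sums ks_summable)
  then show ?e using *(2) unfolding sb b_I set_lebesgue_integral_def by (rule sums_unique2[symmetric])
qed

lemma fourier_problem_ks:
  "fourier_problem (\<lambda>\<beta> t. of_real (kilbas_saigo (3/4) (1/3) (-2/3) (- (1/4) * \<beta>\<^sup>2 * t powr (1/4))))"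
proof -
  have ks: "kilbas_saigo (3/4) (1/3) (-2/3) (- (1/4) * \<beta>\<^sup>2 * t powr (1/4)) = ks_fun (- \<beta>\<^sup>2 * t powr (1/4))" for \<beta> t :: real
    unfolding kilbas_saigo_series ks_fun_def by simp
  let ?U = "\<lambda>\<beta> t. complex_of_real (ks_fun (- \<beta>\<^sup>2 * t powr (1/4)))"
  have "ks_fun 0 = 1"
    unfolding ks_fun_def powser_zero by (rule ks_coeff_0)
  then have "?U \<beta> 0 = 1" for \<beta>
    by simp
  moreover have "continuous_on {0..} (?U \<beta>)" for \<beta>
  proof -
    have "continuous_on UNIV ks_fun"
      by (intro DERIV_continuous_on) (rule has_field_derivative_at_within, rule ks_fun_DERIV)
    moreover have "continuous_on {0..} (\<lambda>t::real. - \<beta>\<^sup>2 * t powr (1/4))"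
      by (intro continuous_on_mult continuous_on_const continuous_on_powr' continuous_on_id) auto
    ultimately have "continuous_on {0..} (\<lambda>t. ks_fun (- \<beta>\<^sup>2 * t powr (1/4)))"
      by (rule continuous_on_compose2) simp
    then show ?thesis by (rule continuous_on_of_real)
  qed
  moreover have "caputo_exists (3/4) (?U \<beta>) t \<and> caputo (3/4) (?U \<beta>) t = - of_real (1/4 * t powr (-1/2) * \<beta>\<^sup>2) * ?U \<beta> t"
    if t: "0 < t" for \<beta> t
  proof -
    let ?c = "- \<beta>\<^sup>2"
    let ?g = "\<lambda>s. (t - s) powr (-3/4) * (?c / 4 * s powr (-3/4) * ks_deriv (?c * s powr (1/4)))"
    have vd: "vector_derivative (?U \<beta>) (at s) = of_real (?c / 4 * s powr (-3/4) * ks_deriv (?c * s powr (1/4)))" if "0 < s" for s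
      by (intro vector_derivative_at ks_fun_powr_deriv that)
    have eq: "indicator {0<..<t} s *\<^sub>R caputo_integrand (3/4) (?U \<beta>) t s = complex_of_real (indicator {0<..<t} s *\<^sub>R ?g s)" for s
    proof (cases "s \<in> {0<..<t}")
      case True
      then have "0 < s" by simp
      from True show ?thesis unfolding caputo_integrand_def vd[OF \<open>0 < s\<close>] by (simp add: scaleR_conv_of_real)
    qed simp
    have "caputo_exists (3/4) (?U \<beta>) t"
      unfolding caputo_exists_def
    proof (intro conjI ballI)
      show "?U \<beta> differentiable (at s)" if "s \<in> {0<..<t}" for s
        using ks_fun_powr_deriv[of s ?c] that by (intro differentiableI_vector) auto
      show "set_integrable lborel {0<..<t} (caputo_integrand (3/4) (?U \<beta>) t)"
        using ks_caputo_integral(1)[OF t, of ?c] unfolding set_integrable_def eq by (rule integrable_of_real)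
    qed
    moreover have "caputo (3/4) (?U \<beta>) t = - of_real (1/4 * t powr (-1/2) * \<beta>\<^sup>2) * ?U \<beta> t"
    proof -
      have G: "Gamma (1/4::real) \<noteq> 0" by (rule Gamma_pos_nonzero) simp
      have "caputo (3/4) (?U \<beta>) t = (1 / Gamma (1/4)) *\<^sub>R of_real (Gamma (1/4) * (?c / 4 * t powr (-1/2) * ks_fun (?c * t powr (1/4))))"
        using ks_caputo_integral(2)[OF t, of ?c]
        unfolding caputo_def set_lebesgue_integral_def eq integral_complex_of_real by simp
      then show ?thesis using G by (simp add: scaleR_conv_of_real)
    qed
    ultimately show ?thesis by blast
  qed
  ultimately show ?thesis
    unfolding fourier_problem_def ks by blast
qed

text \<open>The Caputo derivative of order \<open>\<nu>\<close> is a fractional integral of order \<open>1 - \<nu>\<close> of the derivative; composing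
  with the fractional integral of order \<open>\<nu>\<close> gives, by Fubini and the Beta integral, the integral of the
  derivative over \<open>(0, t)\<close>.  That integral is \<open>f t - f 0\<close> without any continuity of the derivative, since the
  fundamental theorem holds for gauge integrals.\<close>

lemma caputo_inverse:
  fixes f :: "real \<Rightarrow> 'a :: euclidean_space"
  assumes nu: "0 < \<nu>" "\<nu> < 1" and t: "0 < t" and cont: "continuous_on {0..t} f"
    and ex: "caputo_exists \<nu> f t"
  shows "set_integrable lborel {0<..<t} (\<lambda>r. (t - r) powr (\<nu> - 1) *\<^sub>R caputo \<nu> f r)" (is ?i)
    and "(LBINT r:{0<..<t}. (t - r) powr (\<nu> - 1) *\<^sub>R caputo \<nu> f r) = Gamma \<nu> *\<^sub>R (f t - f 0)" (is ?e)
proof -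
  define d where "d s = indicator {0<..<t} s *\<^sub>R vector_derivative f (at s)" for s
  let ?G = "\<lambda>s. indicator {0<..<t} s *\<^sub>R caputo_integrand \<nu> f t s"
  have G: "integrable lborel ?G" using ex by (simp add: caputo_exists_def set_integrable_def)
  have d_G: "d s = (indicator {0<..<t} s * (t - s) powr \<nu>) *\<^sub>R ?G s" for s
    by (auto simp: d_def caputo_integrand_def indicator_def powr_add[symmetric])
  have [measurable]: "?G \<in> borel_measurable borel" using G by auto
  have [measurable]: "d \<in> borel_measurable borel" unfolding d_G[abs_def] by measurable
  \<comment> \<open>The kernel is at least \<open>t powr (- \<nu>)\<close> on \<open>(0, t)\<close>, so integrability of the Caputo integrand at \<open>t\<close> forces integrability of the derivative.\<close>
  have d_int: "integrable lborel d"
  proof (rule Bochner_Integration.integrable_bound)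
    show "integrable lborel (\<lambda>s. t powr \<nu> *\<^sub>R ?G s)" using G by (rule integrable_scaleR_right)
    show "AE s in lborel. norm (d s) \<le> norm (t powr \<nu> *\<^sub>R ?G s)"
    proof (rule AE_I2)
      fix s
      have "indicator {0<..<t} s * (t - s) powr \<nu> \<le> t powr \<nu>"
        using nu t by (auto simp: indicator_def intro!: powr_mono2)
      then show "norm (d s) \<le> norm (t powr \<nu> *\<^sub>R ?G s)"
        unfolding d_G norm_scaleR by (intro mult_right_mono) auto
    qed
  qed simp
  have FTC: "(LBINT s. d s) = f t - f 0"
  proof -
    have "((\<lambda>s. vector_derivative f (at s)) has_integral (f t - f 0)) {0..t}"
      using t cont ex by (intro fundamental_theorem_of_calculus_interior)
        (auto simp: caputo_exists_def vector_derivative_works)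
    then have "((\<lambda>s. vector_derivative f (at s)) has_integral (f t - f 0)) {0<..<t}"
      by (simp add: has_integral_Icc_iff_Ioo)
    then have "((\<lambda>s. if s \<in> {0<..<t} then vector_derivative f (at s) else 0) has_integral (f t - f 0)) UNIV"
      by (subst has_integral_restrict_UNIV)
    moreover have "(\<lambda>s. if s \<in> {0<..<t} then vector_derivative f (at s) else 0) = d"
      by (auto simp: d_def indicator_def)
    ultimately have "(d has_integral (f t - f 0)) UNIV" by simp
    with has_integral_integral_lborel[OF d_int] show ?thesis by (rule has_integral_unique)
  qed
  define k where "k s r = indicator {s<..<t} r *\<^sub>R ((t - r) powr (\<nu> - 1) * (r - s) powr (- \<nu>))" for s r
  have k_nn: "0 \<le> k s r" for s r by (simp add: k_def)
  have [measurable]: "(\<lambda>(s, r). k s r) \<in> borel_measurable (lborel \<Otimes>\<^sub>M lborel)"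
  proof -
    have "(\<lambda>(s, r). k s r) = (\<lambda>(s, r). if s < r \<and> r < t then (t - r) powr (\<nu> - 1) * (r - s) powr (- \<nu>) else 0)"
      by (auto simp: k_def)
    then show ?thesis by simp
  qed
  have k_int: "integrable lborel (k s)" and k_I: "(LBINT r. k s r) = Gamma \<nu> * Gamma (1 - \<nu>)" if s: "s < t" for s
  proof -
    have ts: "0 < t - s" using s by simp
    have sh: "k s (s + 1 * x) = indicator {0<..<t - s} x *\<^sub>R ((t - s - x) powr (\<nu> - 1) * x powr ((1 - \<nu>) - 1))" for x
      by (auto simp: k_def indicator_def diff_diff_eq)
    note B = Beta_lborel[OF nu(1) _ ts, of "1 - \<nu>"]
    show "integrable lborel (k s)"
      apply (subst lborel_integrable_real_affine_iff[of 1 _ s, symmetric])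
      subgoal by simp
      subgoal unfolding sh using B(1) nu by (simp add: set_integrable_def)
      done
    have "(LBINT r. k s r) = (LBINT x. k s (s + 1 * x))"
      by (subst lborel_integral_real_affine[of 1 _ s]) simp_all
    also have "\<dots> = (t - s) powr (\<nu> + (1 - \<nu>) - 1) * Beta \<nu> (1 - \<nu>)"
      unfolding sh using B(2) nu by (simp add: set_lebesgue_integral_def)
    also have "\<dots> = Gamma \<nu> * Gamma (1 - \<nu>)"
      using s nu by (subst Beta_pos_eq) simp_all
    finally show "(LBINT r. k s r) = Gamma \<nu> * Gamma (1 - \<nu>)" .
  qed
  let ?F = "\<lambda>s r. k s r *\<^sub>R d s"
  have d0: "d s = 0" if "\<not> s < t" for s using that by (simp add: d_def)
  have F: "integrable (lborel \<Otimes>\<^sub>M lborel) (case_prod ?F)"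
  proof (rule lborel_pair.Fubini_integrable)
    show "case_prod ?F \<in> borel_measurable (lborel \<Otimes>\<^sub>M lborel)"
      by measurable
    have "(LBINT r. norm (?F s r)) = Gamma \<nu> * Gamma (1 - \<nu>) * norm (d s)" for s
      using k_I[of s] d0[of s] by (cases "s < t") (simp_all add: k_nn)
    then show "integrable lborel (\<lambda>s. LBINT r. norm (case_prod ?F (s, r)))"
      using d_int unfolding prod.case by (simp only: integrable_mult_right integrable_norm)
    show "AE s in lborel. integrable lborel (\<lambda>r. case_prod ?F (s, r))"
    proof (rule AE_I2)
      show "integrable lborel (\<lambda>r. case_prod ?F (s, r))" for s
        using k_int[of s] d0[of s] by (cases "s < t") simp_all
    qed
  qed
  have in_s: "(LBINT s. ?F s r) = Gamma (1 - \<nu>) *\<^sub>R (indicator {0<..<t} r *\<^sub>R ((t - r) powr (\<nu> - 1) *\<^sub>R caputo \<nu> f r))" for r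
  proof -
    have eq: "?F s r = (indicator {0<..<t} r * (t - r) powr (\<nu> - 1)) *\<^sub>R (indicator {0<..<r} s *\<^sub>R caputo_integrand \<nu> f r s)" for s
      by (auto simp: k_def d_def caputo_integrand_def indicator_def)
    have "Gamma (1 - \<nu>) \<noteq> 0" using nu by (intro Gamma_pos_nonzero) simp
    then show ?thesis
      unfolding eq integral_scaleR_right by (simp add: caputo_def set_lebesgue_integral_def)
  qed
  have in_r: "(LBINT r. ?F s r) = (Gamma \<nu> * Gamma (1 - \<nu>)) *\<^sub>R d s" for s
    using k_I[of s] k_int[of s] d0[of s] by (cases "s < t") simp_all
  have G1: "Gamma (1 - \<nu>) \<noteq> 0" using nu by (intro Gamma_pos_nonzero) simp
  have "integrable lborel (\<lambda>r. (1 / Gamma (1 - \<nu>)) *\<^sub>R (LBINT s. ?F s r))"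
    using lborel_pair.integrable_snd[OF F] by (rule integrable_scaleR_right)
  then show ?i using G1 unfolding set_integrable_def in_s by simp
  have "Gamma (1 - \<nu>) *\<^sub>R (LBINT r:{0<..<t}. (t - r) powr (\<nu> - 1) *\<^sub>R caputo \<nu> f r) = (LBINT r. LBINT s. ?F s r)"
    unfolding in_s set_lebesgue_integral_def integral_scaleR_right ..
  also have "\<dots> = (LBINT s. LBINT r. ?F s r)" by (rule lborel_pair.Fubini_integral[OF F])
  also have "\<dots> = Gamma (1 - \<nu>) *\<^sub>R (Gamma \<nu> *\<^sub>R (f t - f 0))"
    unfolding in_r by (simp add: FTC mult.commute)
  finally show ?e using G1 unfolding scaleR_cancel_left by blast
qed

lemma caputo_diff:
  assumes "caputo_exists \<nu> f t" "caputo_exists \<nu> g t"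
  shows "caputo_exists \<nu> (\<lambda>s. f s - g s) t" and "caputo \<nu> (\<lambda>s. f s - g s) t = caputo \<nu> f t - caputo \<nu> g t"
proof -
  have f: "\<And>s. s \<in> {0<..<t} \<Longrightarrow> f differentiable (at s)" "set_integrable lborel {0<..<t} (caputo_integrand \<nu> f t)"
    and g: "\<And>s. s \<in> {0<..<t} \<Longrightarrow> g differentiable (at s)" "set_integrable lborel {0<..<t} (caputo_integrand \<nu> g t)"
    using assms by (auto simp: caputo_exists_def)
  have eq: "indicator {0<..<t} s *\<^sub>R caputo_integrand \<nu> (\<lambda>s. f s - g s) t s =
     indicator {0<..<t} s *\<^sub>R (caputo_integrand \<nu> f t s - caputo_integrand \<nu> g t s)" for s
    using f(1)[of s] g(1)[of s] by (auto simp: indicator_def caputo_integrand_def vector_derivative_diff_at scaleR_diff_right)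
  show "caputo_exists \<nu> (\<lambda>s. f s - g s) t"
    using f(1) g(1) set_integral_diff(1)[OF f(2) g(2)]
    unfolding caputo_exists_def set_integrable_def eq by auto
  show "caputo \<nu> (\<lambda>s. f s - g s) t = caputo \<nu> f t - caputo \<nu> g t"
    using set_integral_diff(2)[OF f(2) g(2)]
    unfolding caputo_def set_lebesgue_integral_def eq by (simp add: scaleR_diff_right)
qed

text \<open>After inversion the equation bounds \<open>\<bar>D\<bar>\<close> by a fractional integral of \<open>r powr (-1/2) * \<bar>D r\<bar>\<close>.  Starting from
  a constant bound on \<open>[0, T]\<close>, each application multiplies the bound by the next Kilbas-Saigo quotient, so
  \<open>\<bar>D\<bar>\<close> is below every term of a convergent series.\<close>

lemma caputo_problem_trivial:
  fixes D :: "real \<Rightarrow> complex"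
  assumes D0: "D 0 = 0" and cont: "continuous_on {0..} D"
    and ex: "\<And>t. 0 < t \<Longrightarrow> caputo_exists (3/4) D t"
    and eq: "\<And>t. 0 < t \<Longrightarrow> caputo (3/4) D t = - of_real (1/4 * t powr (-1/2) * \<beta>\<^sup>2) * D t"
    and T: "0 < T"
  shows "D T = 0"
proof -
  obtain M where M: "\<And>t. t \<in> {0..T} \<Longrightarrow> norm (D t) \<le> M"
  proof -
    have "compact (D ` {0..T})"
      by (intro compact_continuous_image continuous_on_subset[OF cont]) auto
    then have "bounded (D ` {0..T})" by (rule compact_imp_bounded)
    then obtain a where "\<forall>x\<in>{0..T}. norm (D x) \<le> a" by (auto simp: bounded_iff)
    then show ?thesis by (intro that) blast
  qed
  have G: "0 < Gamma (3/4 :: real)" by simp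
  have bound: "norm (D t) \<le> M * (ks_coeff k * (\<beta>\<^sup>2 * t powr (1/4)) ^ k)" if "0 < t" "t \<le> T" for t k
    using that
  proof (induction k arbitrary: t)
    case 0
    then show ?case using M[of t] by (simp add: ks_coeff_0)
  next
    case (Suc k)
    have kp: "0 < (real k + 2) / 4" by simp
    have ct: "continuous_on {0..t} D" by (rule continuous_on_subset[OF cont]) auto
    note ci = caputo_inverse[OF _ _ Suc.prems(1) ct ex[OF Suc.prems(1)], simplified]
    note B = Beta_lborel[OF _ kp Suc.prems(1), of "3/4"]
    define C where "C = \<beta>\<^sup>2 / 4 * (M * (ks_coeff k * (\<beta>\<^sup>2) ^ k))"
    have "Gamma (3/4) * norm (D t) = norm (LBINT r:{0<..<t}. (t - r) powr (3/4 - 1) *\<^sub>R caputo (3/4) D r)"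
      using ci(2) G by (simp add: D0)
    also have "\<dots> \<le> (LBINT r:{0<..<t}. C * ((t - r) powr (3/4 - 1) * r powr ((real k + 2) / 4 - 1)))"
      unfolding set_lebesgue_integral_def
    proof (rule Bochner_Integration.integral_norm_bound_integral)
      show "integrable lborel (\<lambda>r. indicator {0<..<t} r *\<^sub>R (t - r) powr (3 / 4 - 1) *\<^sub>R caputo (3 / 4) D r)"
        using ci(1) by (simp add: set_integrable_def)
      show "integrable lborel (\<lambda>r. indicator {0<..<t} r *\<^sub>R (C * ((t - r) powr (3 / 4 - 1) * r powr ((real k + 2) / 4 - 1))))"
        using set_integrable_mult_right[OF B(1), of C] by (simp add: set_integrable_def)
      fix r
      show "norm (indicator {0<..<t} r *\<^sub>R (t - r) powr (3 / 4 - 1) *\<^sub>R caputo (3 / 4) D r)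
         \<le> indicator {0<..<t} r *\<^sub>R (C * ((t - r) powr (3 / 4 - 1) * r powr ((real k + 2) / 4 - 1)))"
      proof (cases "r \<in> {0<..<t}")
        case True
        then have r: "0 < r" "r \<le> T" using Suc.prems by auto
        have "norm (caputo (3/4) D r) = 1/4 * r powr (-1/2) * \<beta>\<^sup>2 * norm (D r)"
          unfolding eq[OF r(1)] by (simp add: norm_mult abs_mult norm_power)
        also have "\<dots> \<le> 1/4 * r powr (-1/2) * \<beta>\<^sup>2 * (M * (ks_coeff k * (\<beta>\<^sup>2 * r powr (1/4)) ^ k))"
          using Suc.IH[OF r] by (intro mult_left_mono) auto
        also have "\<dots> = C * (r powr (-1/2) * (r powr (1/4)) ^ k)"
          by (simp add: C_def power_mult_distrib mult_ac)
        also have "r powr (-1/2) * (r powr (1/4)) ^ k = r powr ((real k + 2) / 4 - 1)"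
          using r by (simp add: powr_quarter_power powr_add[symmetric] field_simps)
        finally have "(t - r) powr (3/4 - 1) * norm (caputo (3/4) D r) \<le> (t - r) powr (3/4 - 1) * (C * r powr ((real k + 2) / 4 - 1))"
          by (intro mult_left_mono) auto
        then show ?thesis using True by (simp add: mult_ac)
      qed simp
    qed
    also have "\<dots> = C * (t powr (3/4 + (real k + 2) / 4 - 1) * Beta (3/4) ((real k + 2) / 4))"
      using B(2) by (simp add: set_lebesgue_integral_def)
    also have "t powr (3/4 + (real k + 2) / 4 - 1) = (t powr (1/4)) ^ Suc k"
      using Suc.prems by (simp only: powr_quarter_power) (simp add: field_simps)
    finally have "norm (D t) \<le> C * ((t powr (1/4)) ^ Suc k * Beta (3/4) ((real k + 2) / 4)) / Gamma (3/4)"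
      using G by (simp add: pos_le_divide_eq mult.commute)
    also have "\<dots> = M * ((1/4 / Gamma (3/4) * ks_coeff k * Beta (3/4) ((real k + 2) / 4)) * ((\<beta>\<^sup>2) ^ Suc k * (t powr (1/4)) ^ Suc k))"
      by (simp add: C_def mult_ac)
    finally show ?case unfolding ks_coeff_integrate power_mult_distrib by simp
  qed
  have "(\<lambda>k. M * (ks_coeff k * (\<beta>\<^sup>2 * T powr (1/4)) ^ k)) \<longlonglongrightarrow> M * 0"
    by (intro tendsto_mult tendsto_const summable_LIMSEQ_zero ks_summable)
  then have "norm (D T) \<le> M * 0"
    using bound[of T] T by (intro LIMSEQ_le_const) auto
  then show ?thesis by simp
qed

text \<open>The Caputo derivative is linear, so the difference of two solutions solves the problem with initial value 0.\<close>

lemma fourier_problem_unique: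
  assumes U: "fourier_problem U" and V: "fourier_problem V" and t: "0 < t"
  shows "U \<beta> t = V \<beta> t"
proof -
  have "U \<beta> t - V \<beta> t = 0"
  proof (rule caputo_problem_trivial[where D = "\<lambda>t. U \<beta> t - V \<beta> t" and \<beta> = \<beta>])
    show "U \<beta> 0 - V \<beta> 0 = 0" "continuous_on {0..} (\<lambda>t. U \<beta> t - V \<beta> t)"
      using U V by (auto simp: fourier_problem_def intro!: continuous_on_diff)
    fix t :: real assume "0 < t"
    then have *: "caputo_exists (3/4) (U \<beta>) t" "caputo_exists (3/4) (V \<beta>) t"
       "caputo (3/4) (U \<beta>) t = - of_real (1/4 * t powr (-1/2) * \<beta>\<^sup>2) * U \<beta> t"
       "caputo (3/4) (V \<beta>) t = - of_real (1/4 * t powr (-1/2) * \<beta>\<^sup>2) * V \<beta> t"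
      using U V unfolding fourier_problem_def by auto
    show "caputo_exists (3/4) (\<lambda>t. U \<beta> t - V \<beta> t) t" by (rule caputo_diff *)+
    show "caputo (3/4) (\<lambda>t. U \<beta> t - V \<beta> t) t = - of_real (1/4 * t powr (-1/2) * \<beta>\<^sup>2) * (U \<beta> t - V \<beta> t)"
      unfolding caputo_diff(2)[OF *(1,2)] *(3,4) by (simp only: right_diff_distrib)
  qed (rule t)
  then show ?thesis by simp
qed

section \<open>Injectivity of the Fourier transform on integrable functions\<close>

lemma real_distribution_density:
  fixes f :: "real \<Rightarrow> real"
  assumes "prob_space (density lborel (\<lambda>x. ennreal (f x)))"
  shows "real_distribution (density lborel (\<lambda>x. ennreal (f x)))"
  using assms by (simp add: real_distribution_def real_distribution_axioms_def)

lemma char_density: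
  fixes f :: "real \<Rightarrow> real"
  assumes "f \<in> borel_measurable borel" "\<And>x. 0 \<le> f x"
  shows "char (density lborel (\<lambda>x. ennreal (f x))) \<beta> = (CLINT x|lborel. iexp (\<beta> * x) * of_real (f x))"
  unfolding char_def using assms
  by (subst integral_density) (auto simp: scaleR_conv_of_real mult.commute)

lemma prob_space_density_lborel:
  fixes f :: "real \<Rightarrow> real"
  assumes "integrable lborel f" "(LBINT x. f x) = 1" "\<And>x. 0 \<le> f x"
  shows "prob_space (density lborel (\<lambda>x. ennreal (f x)))"
proof
  have [measurable]: "f \<in> borel_measurable borel" using assms(1) by auto
  show "emeasure (density lborel (\<lambda>x. ennreal (f x))) (space (density lborel (\<lambda>x. ennreal (f x)))) = 1"
    using assms by (simp add: emeasure_density nn_integral_eq_integral)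
qed

lemma iexp_mult_integrable:
  fixes f :: "real \<Rightarrow> complex"
  assumes "integrable lborel f"
  shows "integrable lborel (\<lambda>x. iexp (\<beta> * x) * f x)"
  using assms
proof (rule Bochner_Integration.integrable_bound)
  have [measurable]: "f \<in> borel_measurable borel" using assms by auto
  show "(\<lambda>x. iexp (\<beta> * x) * f x) \<in> borel_measurable lborel" by measurable
qed (simp add: norm_mult)

text \<open>If the transform vanishes, the positive and negative parts have equal mass and, once normalised, are
  probability densities with the same characteristic function, so they coincide by Levy's theorem.\<close>

lemma fourier_zero_real:
  fixes g :: "real \<Rightarrow> real"
  assumes g: "integrable lborel g" and zero: "\<And>\<beta>. (CLINT x|lborel. iexp (\<beta> * x) * of_real (g x)) = 0"
  shows "AE x in lborel. g x = 0"
proof -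
  define p where "p x = max 0 (g x)" for x
  define n where "n x = max 0 (- g x)" for x
  have pn: "integrable lborel p" "integrable lborel n"
    unfolding p_def n_def using g by auto
  have [measurable]: "p \<in> borel_measurable borel" "n \<in> borel_measurable borel" using pn by auto
  have nn: "0 \<le> p x" "0 \<le> n x" for x by (auto simp: p_def n_def)
  have g_pn: "g x = p x - n x" for x by (auto simp: p_def n_def)
  have eq: "(CLINT x|lborel. iexp (\<beta> * x) * of_real (p x)) = (CLINT x|lborel. iexp (\<beta> * x) * of_real (n x))" for \<beta>
  proof -
    have "(CLINT x|lborel. iexp (\<beta> * x) * of_real (p x) - iexp (\<beta> * x) * of_real (n x)) = 0"
      using zero[of \<beta>] by (simp add: g_pn right_diff_distrib)
    then show ?thesis
      using Bochner_Integration.integral_diff[OF iexp_mult_integrable iexp_mult_integrable,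
        OF integrable_of_real[OF pn(1)] integrable_of_real[OF pn(2)], of \<beta> \<beta>] by simp
  qed
  define m where "m = (LBINT x. p x)"
  have m_n: "m = (LBINT x. n x)"
    using eq[of 0] by (simp add: m_def)
  have "0 \<le> m" unfolding m_def using nn by (intro integral_nonneg_AE) auto
  show ?thesis
  proof (cases "m = 0")
    case True
    then have "AE x in lborel. p x = 0" "AE x in lborel. n x = 0"
      using m_n pn nn integral_nonneg_eq_0_iff_AE[of lborel p] integral_nonneg_eq_0_iff_AE[of lborel n]
      by (auto simp: m_def)
    then show ?thesis by eventually_elim (simp add: g_pn)
  next
    case False
    with \<open>0 \<le> m\<close> have m: "0 < m" by simp
    let ?P = "density lborel (\<lambda>x. ennreal (p x / m))" and ?N = "density lborel (\<lambda>x. ennreal (n x / m))"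
    have "prob_space ?P"
      using pn m nn by (intro prob_space_density_lborel) (auto simp: m_def)
    moreover have "prob_space ?N"
      using pn m nn m_n by (intro prob_space_density_lborel) auto
    moreover have "char ?P = char ?N"
    proof
      fix \<beta>
      have *: "char (density lborel (\<lambda>x. ennreal (q x / m))) \<beta> = (CLINT x|lborel. iexp (\<beta> * x) * of_real (q x)) / of_real m"
        if "q \<in> borel_measurable borel" "\<And>x. 0 \<le> q x" for q :: "real \<Rightarrow> real"
      proof -
        have "char (density lborel (\<lambda>x. ennreal (q x / m))) \<beta> = (CLINT x|lborel. iexp (\<beta> * x) * of_real (q x / m))"
          using that m by (intro char_density) auto
        also have "\<dots> = (CLINT x|lborel. iexp (\<beta> * x) * of_real (q x) / of_real m)" by simp
        finally show ?thesis unfolding integral_divide_zero .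
      qed
      show "char ?P \<beta> = char ?N \<beta>"
        using nn by (simp only: * eq \<open>p \<in> borel_measurable borel\<close> \<open>n \<in> borel_measurable borel\<close>)
    qed
    ultimately have "?P = ?N"
      by (intro Levy_uniqueness real_distribution_density)
    moreover have "(\<integral>\<^sup>+x. ennreal (p x / m) \<partial>lborel) \<noteq> \<infinity>"
      using pn m nn by (subst nn_integral_eq_integral) auto
    ultimately have "AE x in lborel. ennreal (p x / m) = ennreal (n x / m)"
      by (subst (asm) finite_density_unique) auto
    then show ?thesis
      by eventually_elim (use m nn in \<open>simp add: g_pn\<close>)
  qed
qed

text \<open>Conjugation reflects the frequency, so the real and the imaginary part of a function with vanishing transform
  also have vanishing transforms.\<close>

lemma fourier_L1_unique:
  fixes f g :: "real \<Rightarrow> complex"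
  assumes f: "integrable lborel f" and g: "integrable lborel g"
    and eq: "\<And>\<beta>. (CLINT x|lborel. iexp (\<beta> * x) * f x) = (CLINT x|lborel. iexp (\<beta> * x) * g x)"
  shows "AE x in lborel. f x = g x"
proof -
  define h where "h x = f x - g x" for x
  have h: "integrable lborel h" unfolding h_def using f g by simp
  have ft: "(CLINT x|lborel. iexp (\<beta> * x) * h x) = 0" for \<beta>
    using Bochner_Integration.integral_diff[OF iexp_mult_integrable[OF f] iexp_mult_integrable[OF g], of \<beta> \<beta>] eq[of \<beta>]
    by (simp add: h_def right_diff_distrib)
  have ft_cnj: "(CLINT x|lborel. iexp (\<beta> * x) * cnj (h x)) = 0" for \<beta>
  proof -
    have "(CLINT x|lborel. iexp (\<beta> * x) * cnj (h x)) = (CLINT x|lborel. cnj (iexp (- \<beta> * x) * h x))"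
      by (simp add: exp_cnj)
    also have "\<dots> = cnj (CLINT x|lborel. iexp (- \<beta> * x) * h x)" by (rule Bochner_Integration.integral_cnj)
    finally show ?thesis using ft[of "- \<beta>"] by simp
  qed
  have hc: "integrable lborel (\<lambda>x. cnj (h x))" using h by simp
  note i = iexp_mult_integrable[OF h] iexp_mult_integrable[OF hc]
  have "AE x in lborel. Re (h x) = 0"
  proof (rule fourier_zero_real)
    show "integrable lborel (\<lambda>x. Re (h x))" using h by simp
    fix \<beta>
    have "(CLINT x|lborel. iexp (\<beta> * x) * of_real (Re (h x))) =
        (CLINT x|lborel. (iexp (\<beta> * x) * h x + iexp (\<beta> * x) * cnj (h x)) / 2)"
      by (intro Bochner_Integration.integral_cong) (auto simp: complex_add_cnj simp flip: distrib_left)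
    then show "(CLINT x|lborel. iexp (\<beta> * x) * of_real (Re (h x))) = 0"
      using i[of \<beta>] ft[of \<beta>] ft_cnj[of \<beta>] by (simp only: integral_divide_zero Bochner_Integration.integral_add) simp
  qed
  moreover have "AE x in lborel. Im (h x) = 0"
  proof (rule fourier_zero_real)
    show "integrable lborel (\<lambda>x. Im (h x))" using h by simp
    fix \<beta>
    have "(CLINT x|lborel. iexp (\<beta> * x) * of_real (Im (h x))) =
        (CLINT x|lborel. (iexp (\<beta> * x) * h x - iexp (\<beta> * x) * cnj (h x)) / (2 * \<i>))"
    proof (intro Bochner_Integration.integral_cong refl)
      have Im: "of_real (Im z) = (z - cnj z) / (2 * \<i>)" for z by (simp add: complex_eq_iff Re_divide Im_divide power2_eq_square)
      show "iexp (\<beta> * x) * of_real (Im (h x)) = (iexp (\<beta> * x) * h x - iexp (\<beta> * x) * cnj (h x)) / (2 * \<i>)" for x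
        unfolding Im right_diff_distrib[symmetric] by simp
    qed
    then show "(CLINT x|lborel. iexp (\<beta> * x) * of_real (Im (h x))) = 0"
      using i[of \<beta>] ft[of \<beta>] ft_cnj[of \<beta>] by (simp only: integral_divide_zero Bochner_Integration.integral_diff) simp
  qed
  ultimately show ?thesis
    by eventually_elim (simp add: h_def complex_eq_iff)
qed

section \<open>Brownian motion at an independent random time\<close>

text \<open>Two families of random variables evaluated at a countable random index have equal integrals as soon as
  they do on each event where the index is constant.\<close>

lemma (in finite_measure) integral_countable_selection:
  fixes F G :: "nat \<Rightarrow> 'a \<Rightarrow> complex"
  assumes \<kappa>: "\<kappa> \<in> M \<rightarrow>\<^sub>M count_space UNIV"
    and F: "\<And>k. F k \<in> borel_measurable M" "\<And>k \<omega>. norm (F k \<omega>) \<le> 1"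
    and G: "\<And>k. G k \<in> borel_measurable M" "\<And>k \<omega>. norm (G k \<omega>) \<le> 1"
    and eq: "\<And>k. (\<integral>\<omega>. indicator {k} (\<kappa> \<omega>) * F k \<omega> \<partial>M) = (\<integral>\<omega>. indicator {k} (\<kappa> \<omega>) * G k \<omega> \<partial>M)"
  shows "(\<integral>\<omega>. F (\<kappa> \<omega>) \<omega> \<partial>M) = (\<integral>\<omega>. G (\<kappa> \<omega>) \<omega> \<partial>M)"
proof -
  define A where "A k = \<kappa> -` {k} \<inter> space M" for k
  have A: "A k \<in> sets M" for k unfolding A_def using \<kappa> by (rule measurable_sets) simp
  have UA: "(\<Union>k. A k) = space M" by (auto simp: A_def)
  have split: "(\<integral>\<omega>. H (\<kappa> \<omega>) \<omega> \<partial>M) = (\<Sum>k. \<integral>\<omega>. indicator {k} (\<kappa> \<omega>) * H k \<omega> \<partial>M)"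
    if H: "\<And>k. H k \<in> borel_measurable M" "\<And>k \<omega>. norm (H k \<omega>) \<le> 1" for H :: "nat \<Rightarrow> 'a \<Rightarrow> complex"
  proof -
    have "(\<lambda>\<omega>. H (\<kappa> \<omega>) \<omega>) \<in> borel_measurable M"
      using H(1) \<kappa> by (rule measurable_compose_countable)
    then have "integrable M (\<lambda>\<omega>. H (\<kappa> \<omega>) \<omega>)"
      using H(2) by (intro integrable_const_bound[of _ 1]) auto
    then have "set_integrable M (\<Union>k. A k) (\<lambda>\<omega>. H (\<kappa> \<omega>) \<omega>)"
      unfolding UA by (simp add: set_integrable_def cong: Bochner_Integration.integrable_cong)
    then have "(LINT \<omega>:(\<Union>k. A k)|M. H (\<kappa> \<omega>) \<omega>) = (\<Sum>k. LINT \<omega>:A k|M. H (\<kappa> \<omega>) \<omega>)"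
      by (intro lebesgue_integral_countable_add A) (auto simp: A_def)
    moreover have "(LINT \<omega>:(\<Union>k. A k)|M. H (\<kappa> \<omega>) \<omega>) = (\<integral>\<omega>. H (\<kappa> \<omega>) \<omega> \<partial>M)"
      unfolding UA set_lebesgue_integral_def by (intro Bochner_Integration.integral_cong) auto
    moreover have "(LINT \<omega>:A k|M. H (\<kappa> \<omega>) \<omega>) = (\<integral>\<omega>. indicator {k} (\<kappa> \<omega>) * H k \<omega> \<partial>M)" for k
      unfolding set_lebesgue_integral_def by (intro Bochner_Integration.integral_cong) (auto simp: A_def indicator_def)
    ultimately show ?thesis by simp
  qed
  show ?thesis unfolding split[of F, OF F] split[of G, OF G] eq ..
qed

text \<open>The increment from time 0 has the prescribed normal law, and \<open>B 0\<close> vanishes almost surely.\<close>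

lemma brownian_transform:
  assumes bm: "standard_brownian_motion M B" and s: "0 < s"
  shows "(CLINT \<omega>|M. iexp (\<beta> * B s \<omega>)) = of_real (exp (- (s * \<beta>\<^sup>2 / 2)))"
proof -
  have "\<forall>r s. 0 \<le> r \<and> r < s \<longrightarrow> distributed M lborel (\<lambda>\<omega>. B s \<omega> - B r \<omega>) (normal_density 0 (sqrt (s - r)))"
    using bm unfolding standard_brownian_motion_def by (elim conjE)
  from this[rule_format, of 0 s] s
  have D: "distributed M lborel (\<lambda>\<omega>. B s \<omega> - B 0 \<omega>) (normal_density 0 (sqrt s))"
    by simp
  have [measurable]: "B s \<in> borel_measurable M" "B 0 \<in> borel_measurable M"
    using bm s by (auto simp: standard_brownian_motion_def)
  have "AE \<omega> in M. B 0 \<omega> = 0" using bm by (simp add: standard_brownian_motion_def)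
  then have "(CLINT \<omega>|M. iexp (\<beta> * B s \<omega>)) = (CLINT \<omega>|M. iexp (\<beta> * (B s \<omega> - B 0 \<omega>)))"
    by (intro integral_cong_AE) auto
  also have "\<dots> = (CLINT x|distr M lborel (\<lambda>\<omega>. B s \<omega> - B 0 \<omega>). iexp (\<beta> * x))"
    by (subst integral_distr) auto
  also have "\<dots> = (CLINT x|lborel. iexp (\<beta> * x) * of_real (normal_density 0 (sqrt s) x))"
    unfolding distributed_distr_eq_density[OF D]
    by (subst integral_density) (auto simp: scaleR_conv_of_real mult.commute)
  also have "\<dots> = of_real (exp (- (s * \<beta>\<^sup>2 / 2)))"
    using s by (subst char_normal_density) auto
  finally show ?thesis .
qed

text \<open>Evaluation at a fixed time is measurable for the product sigma-algebra on paths, although evaluation at a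
  random time need not be; this is why the random time has to be discretised below.\<close>

lemma independent_of_process_indep_var:
  assumes M: "prob_space M" and ind: "independent_of_process M W B"
    and [measurable]: "W \<in> borel_measurable M" "B s \<in> borel_measurable M" and s: "0 \<le> s"
  shows "prob_space.indep_var M borel W borel (B s)"
proof -
  interpret prob_space M by (rule M)
  let ?P = "PiM {0::real..} (\<lambda>_. borel :: real measure)"
  let ?p = "\<lambda>\<omega>. \<lambda>s\<in>{0..}. B s \<omega>"
  have "sigma_sets (space M) {B s -` A \<inter> space M |A. A \<in> sets borel} \<subseteq> sets (vimage_algebra (space M) ?p ?P)"
  proof -
    have "B s -` A \<inter> space M \<in> sets (vimage_algebra (space M) ?p ?P)" if A: "A \<in> sets borel" for A
    proof -
      have "(\<lambda>f. f s) -` A \<inter> space ?P \<in> sets ?P"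
        using s A by (intro measurable_sets[OF measurable_component_singleton]) auto
      then have "?p -` ((\<lambda>f. f s) -` A \<inter> space ?P) \<inter> space M \<in> sets (vimage_algebra (space M) ?p ?P)"
        by (rule in_vimage_algebra)
      also have "?p -` ((\<lambda>f. f s) -` A \<inter> space ?P) \<inter> space M = B s -` A \<inter> space M"
        using s by (auto simp: space_PiM)
      finally show ?thesis .
    qed
    then have "{B s -` A \<inter> space M |A. A \<in> sets borel} \<subseteq> sets (vimage_algebra (space M) ?p ?P)"
      by blast
    from sets.sigma_sets_subset[OF this] show ?thesis by simp
  qed
  then show ?thesis
    using ind unfolding indep_var_eq independent_of_process_def indep_sets2_eq sets_vimage_algebra[of _ W]
    by auto
qed

text \<open>Discretising the time from above keeps it positive, so only the one-dimensional laws of \<open>B\<close> at positive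
  times enter.\<close>

lemma brownian_random_time_transform:
  assumes bm: "standard_brownian_motion M B" and W [measurable]: "W \<in> borel_measurable M"
    and pos: "\<And>\<omega>. \<omega> \<in> space M \<Longrightarrow> 0 < W \<omega>" and ind: "independent_of_process M W B"
  shows "(\<lambda>\<omega>. B (W \<omega>) \<omega>) \<in> borel_measurable M" (is ?m)
    and "(CLINT \<omega>|M. iexp (\<beta> * B (W \<omega>) \<omega>)) = (CLINT \<omega>|M. of_real (exp (- (W \<omega> * \<beta>\<^sup>2 / 2))))" (is ?e)
proof -
  have M: "prob_space M" using bm by (simp add: standard_brownian_motion_def)
  interpret prob_space M by (rule M)
  have Bm [measurable]: "B s \<in> borel_measurable M" if "0 \<le> s" for s
    using bm that by (simp add: standard_brownian_motion_def)
  have path: "continuous_on {0..} (\<lambda>s. B s \<omega>)" if "\<omega> \<in> space M" for \<omega>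
    using bm that by (simp add: standard_brownian_motion_def)
  define \<kappa> where "\<kappa> n \<omega> = nat \<lceil>real (Suc n) * W \<omega>\<rceil>" for n \<omega>
  define \<tau> where "\<tau> n \<omega> = real (\<kappa> n \<omega>) / real (Suc n)" for n \<omega>
  have \<kappa>_meas [measurable]: "\<kappa> n \<in> M \<rightarrow>\<^sub>M count_space UNIV" for n
    unfolding \<kappa>_def[abs_def] by measurable
  have \<tau>_bounds: "W \<omega> \<le> \<tau> n \<omega> \<and> \<tau> n \<omega> \<le> W \<omega> + 1 / real (Suc n)" if "\<omega> \<in> space M" for n \<omega>
  proof -
    have p: "0 < real (Suc n) * W \<omega>" using pos[OF that] by simp
    then have "real (\<kappa> n \<omega>) = of_int \<lceil>real (Suc n) * W \<omega>\<rceil>" unfolding \<kappa>_def by simp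
    then have "real (Suc n) * W \<omega> \<le> real (\<kappa> n \<omega>)" "real (\<kappa> n \<omega>) \<le> real (Suc n) * W \<omega> + 1"
      by linarith+
    then show ?thesis by (simp add: \<tau>_def field_simps del: of_nat_Suc)
  qed
  have \<tau>_lim: "(\<lambda>n. \<tau> n \<omega>) \<longlonglongrightarrow> W \<omega>" if "\<omega> \<in> space M" for \<omega>
  proof (rule tendsto_sandwich[of "\<lambda>_. W \<omega>" _ _ "\<lambda>n. W \<omega> + 1 / real (Suc n)"])
    show "(\<lambda>n. W \<omega> + 1 / real (Suc n)) \<longlonglongrightarrow> W \<omega>"
      using tendsto_add[OF tendsto_const[of "W \<omega>"] LIMSEQ_inverse_real_of_nat] by (simp add: divide_inverse)
  qed (use \<tau>_bounds[OF that] in auto)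
  have B_lim: "(\<lambda>n. B (\<tau> n \<omega>) \<omega>) \<longlonglongrightarrow> B (W \<omega>) \<omega>" if "\<omega> \<in> space M" for \<omega>
    by (rule continuous_on_tendsto_compose[OF path[OF that] \<tau>_lim[OF that]])
      (use pos[OF that] in \<open>auto simp: \<tau>_def\<close>)
  have B\<tau> [measurable]: "(\<lambda>\<omega>. B (\<tau> n \<omega>) \<omega>) \<in> borel_measurable M" for n
    unfolding \<tau>_def
    by (rule measurable_compose_countable[where f = "\<lambda>k. B (real k / real (Suc n))"]) (auto simp: \<kappa>_meas)
  show m: ?m
    by (rule borel_measurable_LIMSEQ_metric[OF B\<tau> B_lim])
  have step: "(CLINT \<omega>|M. iexp (\<beta> * B (\<tau> n \<omega>) \<omega>)) = (CLINT \<omega>|M. of_real (exp (- (\<tau> n \<omega> * \<beta>\<^sup>2 / 2))))" for n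
    unfolding \<tau>_def
  proof (rule integral_countable_selection[where \<kappa> = "\<kappa> n" and F = "\<lambda>k \<omega>. iexp (\<beta> * B (real k / real (Suc n)) \<omega>)"
      and G = "\<lambda>k \<omega>. of_real (exp (- (real k / real (Suc n) * \<beta>\<^sup>2 / 2)))"])
    fix k
    let ?s = "real k / real (Suc n)"
    show "(\<lambda>\<omega>. iexp (\<beta> * B ?s \<omega>)) \<in> borel_measurable M" by simp
    show "(\<integral>\<omega>. indicator {k} (\<kappa> n \<omega>) * iexp (\<beta> * B ?s \<omega>) \<partial>M) =
        (CLINT \<omega>|M. indicator {k} (\<kappa> n \<omega>) * of_real (exp (- (?s * \<beta>\<^sup>2 / 2))))"
    proof (cases "k = 0")
      case True
      \<comment> \<open>Positivity of \<open>W\<close> keeps the index away from 0, the one time at which \<open>B\<close> has no normal density.\<close>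
      have "\<kappa> n \<omega> \<noteq> 0" if "\<omega> \<in> space M" for \<omega>
        using mult_pos_pos[OF _ pos[OF that], of "real (Suc n)"] by (simp add: \<kappa>_def del: of_nat_Suc)
      then have "(\<integral>\<omega>. indicator {k} (\<kappa> n \<omega>) * f \<omega> \<partial>M) = (\<integral>\<omega>. 0 \<partial>M)" for f :: "_ \<Rightarrow> complex"
        using True by (intro Bochner_Integration.integral_cong) (auto simp: indicator_def)
      then show ?thesis by (simp only:)
    next
      case False
      then have s: "0 < ?s" by simp
      let ?Y1 = "\<lambda>w. indicator {k} (nat \<lceil>real (Suc n) * w\<rceil>) :: complex" and ?Y2 = "\<lambda>b. iexp (\<beta> * b)"
      have "indep_var borel W borel (B ?s)"
        using s by (intro independent_of_process_indep_var M ind) auto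
      then have "indep_var borel (?Y1 \<circ> W) borel (?Y2 \<circ> B ?s)"
        by (rule indep_var_compose) auto
      moreover have "integrable M (?Y1 \<circ> W)" "integrable M (?Y2 \<circ> B ?s)"
        using s by (auto intro!: integrable_const_bound[of _ 1] simp: indicator_def comp_def)
      ultimately have "(\<integral>\<omega>. (?Y1 \<circ> W) \<omega> * (?Y2 \<circ> B ?s) \<omega> \<partial>M) = (\<integral>\<omega>. (?Y1 \<circ> W) \<omega> \<partial>M) * (\<integral>\<omega>. (?Y2 \<circ> B ?s) \<omega> \<partial>M)"
        by (rule indep_var_lebesgue_integral)
      then show ?thesis
        unfolding comp_def brownian_transform[OF bm s] \<kappa>_def[symmetric] by simp
    qed
  qed auto
  have "(\<lambda>n. CLINT \<omega>|M. iexp (\<beta> * B (\<tau> n \<omega>) \<omega>)) \<longlonglongrightarrow> (CLINT \<omega>|M. iexp (\<beta> * B (W \<omega>) \<omega>))"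
    by (rule integral_dominated_convergence[where w = "\<lambda>_. 1"])
      (use m in \<open>auto intro!: AE_I2 tendsto_intros B_lim\<close>)
  moreover have "(\<lambda>n. CLINT \<omega>|M. iexp (\<beta> * B (\<tau> n \<omega>) \<omega>)) \<longlonglongrightarrow> (CLINT \<omega>|M. of_real (exp (- (W \<omega> * \<beta>\<^sup>2 / 2))))"
    unfolding step
  proof (rule integral_dominated_convergence[where w = "\<lambda>_. 1"])
    show "AE \<omega> in M. norm (complex_of_real (exp (- (\<tau> n \<omega> * \<beta>\<^sup>2 / 2)))) \<le> 1" for n
      by (auto simp: \<tau>_def)
    show "(\<lambda>\<omega>. complex_of_real (exp (- (\<tau> n \<omega> * \<beta>\<^sup>2 / 2)))) \<in> borel_measurable M" for n
      unfolding \<tau>_def by measurable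
  qed (auto intro!: AE_I2 tendsto_intros \<tau>_lim)
  ultimately show ?e by (rule LIMSEQ_unique)
qed

lemma subordinated_brownian_distributed:
  assumes t: "0 < t" and bm: "standard_brownian_motion M B" and pos: "\<And>\<omega>. \<omega> \<in> space M \<Longrightarrow> 0 < W \<omega>"
    and D: "distributed M lborel W (\<lambda>z. ennreal (W_density t z))" and ind: "independent_of_process M W B"
  shows "distributed M lborel (\<lambda>\<omega>. B (W \<omega>) \<omega>) (\<lambda>x. ennreal (mixture_density t x))"
proof -
  interpret prob_space M using bm by (simp add: standard_brownian_motion_def)
  let ?Y = "\<lambda>\<omega>. B (W \<omega>) \<omega>"
  let ?N = "density lborel (\<lambda>x. ennreal (mixture_density t x))"
  have W: "W \<in> borel_measurable M" using distributed_measurable[OF D] by simp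
  have [measurable]: "mixture_density t \<in> borel_measurable borel"
    using mixture_density_integrable(1)[OF t] by auto
  note Y = brownian_random_time_transform[OF bm W pos ind]
  have [measurable]: "?Y \<in> borel_measurable M" by (rule Y(1))
  have "distr M borel ?Y = ?N"
  proof (rule Levy_uniqueness)
    show "real_distribution (distr M borel ?Y)" by simp
    show "real_distribution ?N"
      using t by (intro real_distribution_density prob_space_density_lborel mixture_density_integrable mixture_density_nonneg)
    show "char (distr M borel ?Y) = char ?N"
    proof
      fix \<beta>
      have "char (distr M borel ?Y) \<beta> = (CLINT \<omega>|M. iexp (\<beta> * ?Y \<omega>))"
        unfolding char_def by (subst integral_distr) auto
      also have "\<dots> = of_real (LINT \<omega>|M. exp (- (W \<omega> * \<beta>\<^sup>2 / 2)))"
        using Y(2)[of \<beta>] by (simp only: integral_complex_of_real)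
      also have "(LINT \<omega>|M. exp (- (W \<omega> * \<beta>\<^sup>2 / 2))) = (LBINT z. W_density t z * exp (- (z * \<beta>\<^sup>2 / 2)))"
        by (rule distributed_integral[OF D, symmetric]) (auto intro: W_density_nonneg t)
      also have "of_real \<dots> = (CLINT x|lborel. iexp (\<beta> * x) * of_real (mixture_density t x))"
        unfolding W_density_laplace(2)[OF t] mixture_density_transform(2)[OF t] ..
      also have "\<dots> = char ?N \<beta>"
        by (rule char_density[symmetric]) (auto intro: mixture_density_nonneg t)
      finally show "char (distr M borel ?Y) \<beta> = char ?N \<beta>" .
    qed
  qed
  moreover have "distr M lborel ?Y = distr M borel ?Y" by (intro distr_cong) auto
  ultimately show ?thesis by (simp add: distributed_def)
qed

section \<open>The solution and its probabilistic representation\<close>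

theorem mainTheorem5:
  fixes u :: "real \<Rightarrow> real \<Rightarrow> complex"
  assumes u_def: "\<And>x t. 0 < t \<Longrightarrow> u x t =
      1 / (2 * of_real pi) * (CLINT \<beta>|lborel. iexp (- \<beta> * x) *
        of_real (kilbas_saigo (3/4) (1/3) (-2/3) (- (1/4) * \<beta>\<^sup>2 * t powr (1/4))))"
  shows
    "(\<forall>\<beta> t. 0 < t \<longrightarrow>
        set_integrable lborel {0<..} (\<lambda>w. exp (- w) * w powr (-3/4) * exp (- \<beta>\<^sup>2 * root 4 (t * w))) \<and>
        kilbas_saigo (3/4) (1/3) (-2/3) (- (1/4) * \<beta>\<^sup>2 * t powr (1/4)) =
          Gamma (3/4) / (pi * sqrt 2) *
          (LBINT w:{0<..}. exp (- w) * w powr (-3/4) * exp (- \<beta>\<^sup>2 * root 4 (t * w)))) \<and>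
     (\<forall>x t. 0 < t \<longrightarrow>
        complex_integrable lborel (\<lambda>\<beta>. iexp (- \<beta> * x) *
          of_real (kilbas_saigo (3/4) (1/3) (-2/3) (- (1/4) * \<beta>\<^sup>2 * t powr (1/4))))) \<and>
     delta_solution u \<and>
     (\<forall>v. delta_solution v \<longrightarrow> (\<forall>t>0. AE x in lborel. v x t = u x t)) \<and>
     (\<forall>x t. 0 < t \<longrightarrow>
        set_integrable lborel {0<..}
          (\<lambda>w. exp (- (x\<^sup>2 / (2 * w))) / sqrt (2 * pi * w) * exp (- (w ^ 4 / (2 ^ 4 * t)))) \<and>
        u x t = of_real (sqrt 2 * Gamma (3/4) / (pi * root 4 t) *
          (LBINT w:{0<..}. exp (- (x\<^sup>2 / (2 * w))) / sqrt (2 * pi * w) * exp (- (w ^ 4 / (2 ^ 4 * t)))))) \<and>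
     (\<forall>t>0.
        prob_space (density lborel (\<lambda>z. ennreal (W_density t z))) \<and>
        prob_space (density lborel (\<lambda>x. ennreal (Re (u x t)))) \<and>
        (\<forall>(M :: 'b measure) B W.
           standard_brownian_motion M B \<longrightarrow>
           (\<forall>\<omega>\<in>space M. 0 < W \<omega>) \<longrightarrow>
           distributed M lborel W (\<lambda>z. ennreal (W_density t z)) \<longrightarrow>
           independent_of_process M W B \<longrightarrow>
           distributed M lborel (\<lambda>\<omega>. B (W \<omega>) \<omega>) (\<lambda>x. ennreal (Re (u x t)))))"
proof -
  let ?U = "\<lambda>\<beta> t. kilbas_saigo (3/4) (1/3) (-2/3) (- (1/4) * \<beta>\<^sup>2 * t powr (1/4))"
  have swap: "(\<lambda>\<beta>. iexp (- \<beta> * x) * g \<beta>) = (\<lambda>\<beta>. iexp (- x * \<beta>) * g \<beta>)" for x :: real and g :: "real \<Rightarrow> complex"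
    by (simp add: mult.commute)
  have even: "mixture_density t (- x) = mixture_density t x" for t x
    by (simp add: mixture_density_def normal_density_def)
  have inv: "complex_integrable lborel (\<lambda>\<beta>. iexp (- \<beta> * x) * of_real (?U \<beta> t))"
    and inv_eq: "(CLINT \<beta>|lborel. iexp (- \<beta> * x) * of_real (?U \<beta> t)) = of_real (2 * pi * mixture_density t x)"
    if "0 < t" for x t
    unfolding swap using mixture_density_inversion[OF that, of "- x"] unfolding even .
  have u_eq: "u x t = of_real (mixture_density t x)" if "0 < t" for x t
    unfolding u_def[OF that] inv_eq[OF that] by simp
  have transform: "integrable lborel (\<lambda>x. u x t)" "(CLINT x|lborel. iexp (\<beta> * x) * u x t) = of_real (?U \<beta> t)"
    if "0 < t" for t \<beta>
    unfolding u_eq[OF that]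
    using integrable_of_real[OF mixture_density_integrable(1)[OF that]] mixture_density_transform(2)[OF that] by auto
  have sol: "delta_solution u"
    unfolding delta_solution_def
  proof (intro exI[of _ "\<lambda>\<beta> t. of_real (?U \<beta> t)"] conjI fourier_problem_ks allI impI)
    fix \<beta> t :: real assume t: "0 < t"
    show "integrable lborel (\<lambda>x. u x t)" by (rule transform(1)[OF t])
    show "of_real (?U \<beta> t) = (CLINT x|lborel. iexp (\<beta> * x) * u x t)" by (rule transform(2)[OF t, symmetric])
  qed
  have uniq: "AE x in lborel. v x t = u x t" if v: "delta_solution v" and t: "0 < t" for v t
  proof -
    obtain V where V: "fourier_problem V" "integrable lborel (\<lambda>x. v x t)"
      "\<And>\<beta>. V \<beta> t = (CLINT x|lborel. iexp (\<beta> * x) * v x t)"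
      using v t unfolding delta_solution_def by auto
    show ?thesis
    proof (rule fourier_L1_unique[OF V(2) transform(1)[OF t]])
      fix \<beta>
      show "(CLINT x|lborel. iexp (\<beta> * x) * v x t) = (CLINT x|lborel. iexp (\<beta> * x) * u x t)"
        unfolding V(3)[symmetric] transform(2)[OF t]
        by (rule fourier_problem_unique[OF V(1) fourier_problem_ks t])
    qed
  qed
  have dens: "prob_space (density lborel (\<lambda>z. ennreal (W_density t z)))"
    "prob_space (density lborel (\<lambda>x. ennreal (mixture_density t x)))" if "0 < t" for t
    by (intro prob_space_density_lborel W_density_integrable W_density_integral W_density_nonneg
        mixture_density_integrable mixture_density_nonneg that)+
  show ?thesis
  proof (intro conjI allI impI)
    fix \<beta> t :: real assume t: "0 < t"
    show "set_integrable lborel {0<..} (\<lambda>w. exp (- w) * w powr (-3/4) * exp (- \<beta>\<^sup>2 * root 4 (t * w)))"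
      by (rule kilbas_saigo_integral(1)[OF t])
    show "?U \<beta> t = Gamma (3/4) / (pi * sqrt 2) *
          (LBINT w:{0<..}. exp (- w) * w powr (-3/4) * exp (- \<beta>\<^sup>2 * root 4 (t * w)))"
      by (rule kilbas_saigo_integral(2)[OF t])
  next
    fix x t :: real assume t: "0 < t"
    show "complex_integrable lborel (\<lambda>\<beta>. iexp (- \<beta> * x) * of_real (?U \<beta> t))"
      by (rule inv[OF t])
    show "set_integrable lborel {0<..}
          (\<lambda>w. exp (- (x\<^sup>2 / (2 * w))) / sqrt (2 * pi * w) * exp (- (w ^ 4 / (2 ^ 4 * t))))"
      by (rule mixture_density_eq(1)[OF t])
    show "u x t = of_real (sqrt 2 * Gamma (3/4) / (pi * root 4 t) *
          (LBINT w:{0<..}. exp (- (x\<^sup>2 / (2 * w))) / sqrt (2 * pi * w) * exp (- (w ^ 4 / (2 ^ 4 * t)))))"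
      unfolding u_eq[OF t] mixture_density_eq(2)[OF t] ..
  next
    show "delta_solution u" by (rule sol)
  next
    fix v :: "real \<Rightarrow> real \<Rightarrow> complex" and t :: real
    assume "delta_solution v" "0 < t"
    then show "AE x in lborel. v x t = u x t" by (rule uniq)
  next
    fix t :: real assume t: "0 < t"
    show "prob_space (density lborel (\<lambda>z. ennreal (W_density t z)))" by (rule dens(1)[OF t])
    show "prob_space (density lborel (\<lambda>x. ennreal (Re (u x t))))"
      unfolding u_eq[OF t] Re_complex_of_real by (rule dens(2)[OF t])
    fix M :: "'b measure" and B W
    assume "standard_brownian_motion M B" "\<forall>\<omega>\<in>space M. 0 < W \<omega>"
      "distributed M lborel W (\<lambda>z. ennreal (W_density t z))" "independent_of_process M W B"
    then show "distributed M lborel (\<lambda>\<omega>. B (W \<omega>) \<omega>) (\<lambda>x. ennreal (Re (u x t)))"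
      unfolding u_eq[OF t] Re_complex_of_real by (intro subordinated_brownian_distributed t) auto
  qed
qed

end
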